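(* Let $\alpha>0$, $\beta,h,\mu,\Omega_0,\Omega_1\in\mathbb{R}$, $c\in(-1,1)$, $\bar\beta(\theta):=\beta/(1+c\cos\theta)$ and $\Omega=\Omega_0+\Omega_1s$. Suppose the parameters are a 'bandgap' parameter set, that is, there is $s_1>0$ such that for every $s$ with $|s|>s_1$ there exist no wavetrains (with $\theta\in(0,\pi)$) whose wavenumber is $$q=\frac{\Omega-\bar\beta(\theta)/\alpha}{s}.$$ Then there exist fast domain wall type coherent structures spatially connecting $\boldsymbol{\hat e}_3$ and $-\boldsymbol{\hat e}_3$, with superimposed frequency $\Omega=\Omega_0+\Omega_1 s$, for all velocities $s$ with $|s|$ sufficiently large, of the equation $$\partial_t\boldsymbol m=\boldsymbol m\times\Big[\alpha\partial_t\boldsymbol m-\partial_x^2\boldsymbol m+(\mu m_3-h)\boldsymbol{\hat e}_3+\frac{\beta}{1+c\,m_3}\,\boldsymbol m\times\boldsymbol{\hat e}_3\Big],\qquad \boldsymbol m(x,t)\in\mathbb{S}^2,\ x\in\mathbb{R}.$$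
   Context: Write $\boldsymbol m=(e^{i\varphi}\sin\theta,\cos\theta)$, identifying the $(m_1,m_2)$-plane with $\mathbb{C}$. Wavetrains with wavenumber $k$ and frequency $\omega$ are solutions with $\varphi=kx-\omega t$ and constant $\theta$, $\sin\theta\neq0$; they satisfy $-\alpha\omega=\bar\beta(\theta)$ and $-\omega=(k^2-\mu)\cos\theta+h$. Coherent structures with velocity $s$ and superimposed frequency $\Omega$ are solutions of the form $\xi=x-st$, $\varphi=\phi(\xi)+\Omega t$, $\theta=\theta(\xi)$; with $q=\phi'$ they satisfy $$\theta'=p,\quad p'=\sin\theta\,\big(h+(q^2-\mu)\cos\theta-(\Omega-sq)\big)-\alpha sp,\quad q'=\alpha(\Omega-sq)-\bar\beta(\theta)-\frac{s+2\cos(\theta)q}{\sin\theta}\,p,$$ whose equilibria with $\theta\in(0,\pi)$ are the wavetrains with wavenumber $q=(\Omega-\bar\beta(\theta)/\alpha)/s$ and frequency $sq-\Omega$. Domain wall type means that $\theta(\xi)$ converges to $0$ at one end and to $\pi$ at the other end as $\xi\to\pm\infty$. *)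

theory Defs
  imports "HOL-Analysis.Analysis"
begin

definition e3 :: "real^3" where
  "e3 = axis 3 1"

definition polar :: "real \<Rightarrow> real \<Rightarrow> real^3" where
  "polar \<phi> \<theta> = vector [cos \<phi> * sin \<theta>, sin \<phi> * sin \<theta>, cos \<theta>]"

definition beta_bar :: "real \<Rightarrow> real \<Rightarrow> real \<Rightarrow> real" where
  "beta_bar \<beta> c \<theta> = \<beta> / (1 + c * cos \<theta>)"

(* Arguments of m: space x first, then time t.  Solutions are classical: the derivatives
   m_t, m_x, m_xx exist everywhere and m_t, m_xx are jointly continuous. *)
definition llgs_solution ::
  "real \<Rightarrow> real \<Rightarrow> real \<Rightarrow> real \<Rightarrow> real \<Rightarrow> (real \<Rightarrow> real \<Rightarrow> real^3) \<Rightarrow> bool" where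
  "llgs_solution \<alpha> \<beta> c h \<mu> m \<longleftrightarrow>
     (\<forall>x t. norm (m x t) = 1) \<and>
     (\<exists>mt mx mxx.
        (\<forall>x t. ((\<lambda>\<tau>. m x \<tau>) has_vector_derivative mt x t) (at t)) \<and>
        (\<forall>x t. ((\<lambda>y. m y t) has_vector_derivative mx x t) (at x)) \<and>
        (\<forall>x t. ((\<lambda>y. mx y t) has_vector_derivative mxx x t) (at x)) \<and>
        continuous_on UNIV (\<lambda>(x, t). mt x t) \<and>
        continuous_on UNIV (\<lambda>(x, t). mxx x t) \<and>
        (\<forall>x t. mt x t =
           cross3 (m x t)
             (\<alpha> *\<^sub>R mt x t - mxx x t + (\<mu> * m x t $ 3 - h) *\<^sub>R e3
              + (\<beta> / (1 + c * m x t $ 3)) *\<^sub>R cross3 (m x t) e3)))"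

definition wavetrain ::
  "real \<Rightarrow> real \<Rightarrow> real \<Rightarrow> real \<Rightarrow> real \<Rightarrow> real \<Rightarrow> real \<Rightarrow> real \<Rightarrow> bool" where
  "wavetrain \<alpha> \<beta> c h \<mu> k \<omega> \<theta> \<longleftrightarrow>
     sin \<theta> \<noteq> 0 \<and> llgs_solution \<alpha> \<beta> c h \<mu> (\<lambda>x t. polar (k * x - \<omega> * t) \<theta>)"

(* The condition sin (\<theta> \<xi>) \<noteq> 0 keeps the profile away from the poles, where the polar
   coordinates, and hence \<phi>' as local wavenumber, are singular. *)
definition coherent_structure ::
  "real \<Rightarrow> real \<Rightarrow> real \<Rightarrow> real \<Rightarrow> real \<Rightarrow> real \<Rightarrow> real \<Rightarrow> (real \<Rightarrow> real) \<Rightarrow> (real \<Rightarrow> real) \<Rightarrow> bool" where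
  "coherent_structure \<alpha> \<beta> c h \<mu> s \<Omega> \<phi> \<theta> \<longleftrightarrow>
     (\<forall>\<xi>. sin (\<theta> \<xi>) \<noteq> 0) \<and>
     \<phi> differentiable_on UNIV \<and> deriv \<phi> differentiable_on UNIV \<and>
     \<theta> differentiable_on UNIV \<and> deriv \<theta> differentiable_on UNIV \<and>
     llgs_solution \<alpha> \<beta> c h \<mu> (\<lambda>x t. polar (\<phi> (x - s * t) + \<Omega> * t) (\<theta> (x - s * t)))"

(* e3 corresponds to \<theta> = 0 and - e3 to \<theta> = pi; either orientation is allowed. *)
definition domain_wall_type :: "(real \<Rightarrow> real) \<Rightarrow> bool" where
  "domain_wall_type \<theta> \<longleftrightarrow>
     ((\<theta> \<longlongrightarrow> 0) at_bot \<and> (\<theta> \<longlongrightarrow> pi) at_top) \<or>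
     ((\<theta> \<longlongrightarrow> pi) at_bot \<and> (\<theta> \<longlongrightarrow> 0) at_top)"

(* With \<Omega> = \<Omega>0 + \<Omega>1 * s; the \<theta> in the wavenumber is the one of the wavetrain itself, and
   its frequency is left arbitrary. *)
definition bandgap ::
  "real \<Rightarrow> real \<Rightarrow> real \<Rightarrow> real \<Rightarrow> real \<Rightarrow> real \<Rightarrow> real \<Rightarrow> bool" where
  "bandgap \<alpha> \<beta> c h \<mu> \<Omega>0 \<Omega>1 \<longleftrightarrow>
     (\<exists>s1>0. \<forall>s. \<bar>s\<bar> > s1 \<longrightarrow>
        \<not> (\<exists>\<theta>\<in>{0<..<pi}. \<exists>\<omega>.
             wavetrain \<alpha> \<beta> c h \<mu> ((\<Omega>0 + \<Omega>1 * s - beta_bar \<beta> c \<theta> / \<alpha>) / s) \<omega> \<theta>))"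

end

theory Submission
  imports Defs
begin

text \<open>
  For large speeds \<open>\<bar>s\<bar>\<close> the profile equations are a slow-fast system. With \<open>\<epsilon> = 1 / s\<close>, the
  variables \<open>w = s * \<theta>' / sin \<theta>\<close> and \<open>Q = \<Omega> - s * \<phi>'\<close> relax in the time \<open>t = s * \<xi>\<close> at rate \<open>\<alpha>\<close>, while
  the angle \<open>\<theta>\<close> moves with speed of order \<open>\<epsilon>\<^sup>2\<close>. Hence there is an attracting slow manifold on which
  \<open>w\<close> and \<open>Q\<close> are functions of \<open>\<theta>\<close>, and on it the profile reduces to the scalar equation
  \<open>\<theta>' = \<epsilon> * w(\<theta>) * sin \<theta>\<close> on \<open>(0, pi)\<close>.

  The rest points of this scalar equation in \<open>(0, pi)\<close> are the zeros of \<open>w\<close>; by invariance of the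
  slow manifold they are rest points of the full system, and these are precisely the wavetrains with the
  wavenumber excluded by the bandgap condition. So \<open>w\<close> has no zero, \<open>\<theta>\<close> is strictly monotone in \<open>\<xi>\<close>, and it
  must run from one pole to the other. The argument is applied for each \<open>s\<close> separately and not to the
  limit \<open>\<epsilon> = 0\<close>. In that limit \<open>w\<close> may well have degenerate zeros, so the connection is not obtained by
  perturbing a limiting one.

  The slow manifold is constructed by the method of Lyapunov and Perron. The coordinate \<open>a\<close> with
  \<open>tan (\<theta> / 2) = exp a\<close> removes the singularities at the poles and turns the slow equation into
  \<open>a' = \<epsilon>\<^sup>2 * w\<close>; the two fast variables combine to \<open>z = w + \<i> * Q\<close> with
  \<open>z' = (- \<alpha> + \<i>) * z + F a z\<close>. An orbit that is bounded for all times is a fixed point of a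
  contraction in an exponentially weighted norm (\<open>bounded_orbit_exists\<close>); it depends in a
  Lipschitz way on \<open>a\<close> at time zero (\<open>bounded_orbits_Lipschitz\<close>), and this yields the invariant graph
  (\<open>slow_manifold\<close>) and the orbit from \<open>a = \<plusminus>\<infinity>\<close> to \<open>a = \<mp>\<infinity>\<close> (\<open>connecting_orbit\<close>). The translation
  back to the partial differential equation is \<open>travelling_profile_solves_llgs\<close>, a computation in the
  moving frame of spherical coordinates.
\<close>

section \<open>Bounded solutions of linear equations\<close>

lemma continuous_imp_antiderivative:
  fixes f :: "real \<Rightarrow> 'a::euclidean_space"
  assumes "continuous_on UNIV f"
  obtains g where "\<And>t. (g has_vector_derivative f t) (at t)" and "g 0 = a"
proof
  let ?G = "\<lambda>u. LBINT y=ereal 0..ereal u. f y"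
  fix t
  have "((\<lambda>u. LBINT y=ereal 0..ereal u. f y) has_vector_derivative f t) (at t within {-\<bar>t\<bar>-1..\<bar>t\<bar>+1})"
    by (rule interval_integral_FTC2) (use assms in \<open>auto intro: continuous_on_subset\<close>)
  then have "(?G has_vector_derivative f t) (at t)"
    by (subst (asm) at_within_Icc_at) auto
  then show "((\<lambda>u. a + ?G u) has_vector_derivative f t) (at t)"
    by (auto intro!: derivative_eq_intros)
  show "a + ?G 0 = a" by (simp add: zero_ereal_def)
qed

text \<open>
  The mean value inequality with an exponential majorant. It stands in for all integral estimates
  below, so that no improper integral over a half-line is ever needed.
\<close>

lemma exp_derivative_increment:
  fixes H :: "real \<Rightarrow> 'a::real_normed_vector"
  assumes deriv: "\<And>s. (H has_vector_derivative g s) (at s)"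
    and bound: "\<And>s. r \<le> s \<Longrightarrow> s \<le> t \<Longrightarrow> norm (g s) \<le> B * exp (k * s)"
    and "k > 0" "r \<le> t"
  shows "norm (H t - H r) \<le> B / k * (exp (k * t) - exp (k * r))"
proof (cases "r = t")
  case False
  then have "r < t" using assms by simp
  have cont: "continuous_on S H" for S
    by (meson continuous_at_imp_continuous_on deriv has_vector_derivative_continuous)
  have "norm (H t - H r) \<le> B / k * exp (k * t) - B / k * exp (k * r)"
  proof (rule differentiable_bound_general[OF \<open>r < t\<close> cont])
    show "continuous_on {r..t} (\<lambda>s. B / k * exp (k * s))"
      by (intro continuous_intros)
    show "(H has_vector_derivative g s) (at s)" for s by (rule deriv)
    show "((\<lambda>s. B / k * exp (k * s)) has_vector_derivative B * exp (k * s)) (at s)" for s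
      unfolding has_real_derivative_iff_has_vector_derivative[symmetric]
      using \<open>k > 0\<close> by (auto intro!: derivative_eq_intros)
  qed (use bound in auto)
  then show ?thesis by (simp add: right_diff_distrib)
qed simp

lemma exp_has_vector_derivative:
  fixes lam :: complex
  shows "((\<lambda>s. exp (lam * of_real s)) has_vector_derivative exp (lam * of_real t) * lam) (at t)"
  by (rule has_vector_derivative_real_field) (auto intro!: derivative_eq_intros)

lemma linear_equation_integrating_factor:
  fixes lam :: complex and Z :: "real \<Rightarrow> complex"
  assumes "(Z has_vector_derivative lam * Z t + f) (at t)"
  shows "((\<lambda>s. exp (- lam * of_real s) * Z s) has_vector_derivative exp (- lam * of_real t) * f) (at t)"
proof -
  have "((\<lambda>s. exp (- lam * of_real s)) has_vector_derivative exp (- lam * of_real t) * (- lam)) (at t)"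
    by (rule exp_has_vector_derivative)
  from has_vector_derivative_mult[OF this assms] show ?thesis
    by (simp add: algebra_simps)
qed

text \<open>
  Since \<open>Re lam < 0\<close>, a solution stays bounded in backward time only if it is
  \<open>\<integral> exp (lam * (t - s)) * f s ds\<close> over \<open>s \<le> t\<close>. This integral is obtained as
  \<open>exp (lam * t) * (H t - H0)\<close>, where \<open>H\<close> is an antiderivative of \<open>exp (- lam * s) * f s\<close>
  and \<open>H0\<close> its limit at \<open>- \<infinity>\<close>.
\<close>

lemma linear_bounded_solution_exists:
  fixes lam :: complex and f :: "real \<Rightarrow> complex"
  assumes cont: "continuous_on UNIV f" and f: "\<And>t. norm (f t) \<le> M" and lam: "Re lam < 0"
  obtains Z where "\<And>t. (Z has_vector_derivative lam * Z t + f t) (at t)"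
    and "\<And>t. norm (Z t) \<le> M / (- Re lam)"
proof -
  define k where "k = - Re lam"
  have k: "k > 0" using lam by (simp add: k_def)
  have M: "M \<ge> 0" using f[of 0] norm_ge_zero order_trans by blast
  define g where "g s = exp (- lam * of_real s) * f s" for s
  have "continuous_on UNIV g"
    unfolding g_def by (intro continuous_intros cont)
  then obtain H where H: "\<And>t. (H has_vector_derivative g t) (at t)"
    using continuous_imp_antiderivative by blast
  have g: "norm (g s) \<le> M * exp (k * s)" for s
    using f[of s] by (simp add: g_def norm_mult k_def mult.commute)
  have incr: "norm (H t - H r) \<le> M / k * exp (k * t)" if "r \<le> t" for r t
  proof -
    have "norm (H t - H r) \<le> M / k * (exp (k * t) - exp (k * r))"
      by (rule exp_derivative_increment[OF H _ k that]) (rule g)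
    also have "\<dots> \<le> M / k * exp (k * t)"
      using M k by (intro mult_left_mono) auto
    finally show ?thesis .
  qed
  have lim0: "(\<lambda>n. M / k * exp (k * (- real n))) \<longlonglongrightarrow> 0"
  proof -
    have "filterlim (\<lambda>n. k * (- real n)) at_bot sequentially"
      using k by (intro filterlim_tendsto_pos_mult_at_bot[OF tendsto_const])
        (auto intro!: filterlim_compose[OF filterlim_uminus_at_bot_at_top] filterlim_real_sequentially)
    then have "(\<lambda>n. exp (k * (- real n))) \<longlonglongrightarrow> 0"
      by (rule filterlim_compose[OF exp_at_bot])
    then show ?thesis using tendsto_mult_right_zero by blast
  qed
  have "Cauchy (\<lambda>n. H (- real n))"
  proof (rule CauchyI')
    fix e :: real assume "e > 0"
    with lim0 have "\<forall>\<^sub>F n in sequentially. M / k * exp (k * (- real n)) < e"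
      by (intro order_tendstoD)
    then obtain N where N: "\<And>n. n \<ge> N \<Longrightarrow> M / k * exp (k * (- real n)) < e"
      by (auto simp: eventually_sequentially)
    have "dist (H (- real m)) (H (- real n)) < e" if "m \<ge> N" "n > m" for m n
      using incr[of "- real n" "- real m"] N[of m] that by (auto simp: dist_norm)
    then show "\<exists>N. \<forall>m\<ge>N. \<forall>n>m. dist (H (- real m)) (H (- real n)) < e" by blast
  qed
  then obtain H0 where H0: "(\<lambda>n. H (- real n)) \<longlonglongrightarrow> H0"
    using Cauchy_convergent convergent_def by blast
  have bd: "norm (H t - H0) \<le> M / k * exp (k * t)" for t
  proof (rule tendsto_upperbound)
    show "(\<lambda>n. norm (H t - H (- real n))) \<longlonglongrightarrow> norm (H t - H0)"
      by (intro tendsto_intros H0)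
    have "norm (H t - H (- real n)) \<le> M / k * exp (k * t)" if "n \<ge> nat \<lceil>- t\<rceil>" for n
      using that by (intro incr) linarith
    then show "\<forall>\<^sub>F n in sequentially. norm (H t - H (- real n)) \<le> M / k * exp (k * t)"
      by (intro eventually_sequentiallyI)
  qed auto
  define Z where "Z t = exp (lam * of_real t) * (H t - H0)" for t
  show ?thesis
  proof
    fix t
    have "((\<lambda>s. exp (lam * of_real s)) has_vector_derivative exp (lam * of_real t) * lam) (at t)"
      by (rule exp_has_vector_derivative)
    moreover have "((\<lambda>s. H s - H0) has_vector_derivative g t) (at t)"
      by (auto intro!: derivative_eq_intros H)
    ultimately have "(Z has_vector_derivative
        exp (lam * of_real t) * g t + exp (lam * of_real t) * lam * (H t - H0)) (at t)"
      unfolding Z_def by (rule has_vector_derivative_mult)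
    moreover have "exp (lam * of_real t) * g t + exp (lam * of_real t) * lam * (H t - H0)
        = lam * Z t + f t"
      by (simp add: g_def Z_def exp_minus)
    ultimately show "(Z has_vector_derivative lam * Z t + f t) (at t)" by simp
    have "norm (Z t) = exp (- k * t) * norm (H t - H0)"
      by (simp add: Z_def norm_mult k_def)
    also have "\<dots> \<le> exp (- k * t) * (M / k * exp (k * t))"
      by (intro mult_left_mono bd) simp
    also have "\<dots> = M / k" by (simp add: exp_minus)
    finally show "norm (Z t) \<le> M / (- Re lam)" by (simp add: k_def)
  qed
qed

text \<open>
  A bounded solution forgets its past at the rate \<open>- Re lam\<close>, so it inherits from the forcing any
  growth slower than that. Applied to differences of solutions this yields uniqueness and
  continuous dependence, and the weight \<open>exp (d * \<bar>t\<bar>)\<close> leaves room for slow variables that drift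
  apart linearly in time.
\<close>

lemma linear_bounded_solution_weighted_bound:
  fixes lam :: complex and f Z :: "real \<Rightarrow> complex"
  assumes deriv: "\<And>t. (Z has_vector_derivative lam * Z t + f t) (at t)"
    and Z: "\<And>t. norm (Z t) \<le> R"
    and f: "\<And>t. norm (f t) \<le> B * exp (d * \<bar>t\<bar>)" and d: "0 \<le> d" "d < - Re lam"
  shows "norm (Z t) \<le> B / (- Re lam - d) * exp (d * \<bar>t\<bar>)"
proof -
  define k where "k = - Re lam"
  have k: "k - d > 0" "k > 0" using d by (auto simp: k_def)
  have "0 \<le> norm (f 0)" by simp
  also have "\<dots> \<le> B" using f[of 0] by simp
  finally have B: "B \<ge> 0" .
  define V where "V s = exp (- lam * of_real s) * Z s" for s
  \<comment> \<open>For \<open>s \<le> t\<close> the weight is dominated by \<open>exp (d * (\<bar>t\<bar> + t - s))\<close>, which has no kink in \<open>s\<close>.\<close>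
  define C where "C = B * exp (d * \<bar>t\<bar> + d * t)"
  have nV: "norm (V s) = exp (k * s) * norm (Z s)" for s
    by (simp add: V_def norm_mult k_def)
  have V: "(V has_vector_derivative exp (- lam * of_real s) * f s) (at s)" for s
    unfolding V_def by (rule linear_equation_integrating_factor[OF deriv])
  have g: "norm (exp (- lam * of_real s) * f s) \<le> C * exp ((k - d) * s)" if "s \<le> t" for s
  proof -
    have "norm (exp (- lam * of_real s) * f s) = exp (k * s) * norm (f s)"
      by (simp add: norm_mult k_def)
    also have "\<dots> \<le> exp (k * s) * (B * exp (d * \<bar>s\<bar>))"
      by (intro mult_left_mono f) simp
    also have "\<dots> \<le> exp (k * s) * (B * exp (d * (\<bar>t\<bar> + t - s)))"
      using B d that by (intro mult_left_mono) (auto intro!: mult_left_mono)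
    also have "\<dots> = C * exp ((k - d) * s)"
      by (simp add: C_def algebra_simps flip: exp_add)
    finally show ?thesis .
  qed
  have incr: "norm (V t) \<le> C / (k - d) * exp ((k - d) * t) + exp (k * r) * R" if "r \<le> t" for r
  proof -
    have "norm (V t) \<le> norm (V t - V r) + norm (V r)"
      by (metis diff_add_cancel norm_triangle_ineq)
    also have "norm (V t - V r) \<le> C / (k - d) * (exp ((k - d) * t) - exp ((k - d) * r))"
      by (rule exp_derivative_increment[OF V g k(1) that])
    also have "\<dots> \<le> C / (k - d) * exp ((k - d) * t)"
      using B k by (intro mult_left_mono) (auto simp: C_def)
    also have "norm (V r) \<le> exp (k * r) * R"
      unfolding nV by (intro mult_left_mono Z) simp
    finally show ?thesis by simp
  qed
  have "norm (V t) \<le> C / (k - d) * exp ((k - d) * t)"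
  proof (rule tendsto_lowerbound)
    have "filterlim (\<lambda>r. k * r) at_bot at_bot"
      using k by (intro filterlim_tendsto_pos_mult_at_bot[OF tendsto_const]) (auto simp: filterlim_ident)
    then have "((\<lambda>r. exp (k * r)) \<longlongrightarrow> 0) at_bot"
      by (rule filterlim_compose[OF exp_at_bot])
    then have "((\<lambda>r. C / (k - d) * exp ((k - d) * t) + exp (k * r) * R) \<longlongrightarrow>
       C / (k - d) * exp ((k - d) * t) + 0 * R) at_bot"
      by (intro tendsto_intros)
    then show "((\<lambda>r. C / (k - d) * exp ((k - d) * t) + exp (k * r) * R) \<longlongrightarrow>
       C / (k - d) * exp ((k - d) * t)) at_bot" by simp
    show "\<forall>\<^sub>F r in at_bot. norm (V t) \<le> C / (k - d) * exp ((k - d) * t) + exp (k * r) * R"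
      using eventually_le_at_bot[of t] by eventually_elim (rule incr)
  qed simp
  also have "\<dots> = exp (k * t) * (B / (k - d) * exp (d * \<bar>t\<bar>))"
    by (simp add: C_def algebra_simps flip: exp_add)
  finally have "norm (Z t) \<le> B / (k - d) * exp (d * \<bar>t\<bar>)"
    unfolding nV by (subst (asm) mult_le_cancel_left_pos) auto
  then show ?thesis by (simp add: k_def)
qed

section \<open>The slow manifold\<close>

text \<open>
  A real slow variable \<open>A\<close> with \<open>A' = nu * Re Z\<close> drives a complex fast variable \<open>Z\<close> with
  \<open>Z' = lam * Z + F A Z\<close>. The bound on \<open>F\<close> makes the ball of radius \<open>R\<close> invariant under the
  solution operator of the linear equation. The inequality \<open>gap\<close> is the spectral gap condition:
  in the norm with weight \<open>exp (d * \<bar>t\<bar>)\<close>, \<open>d = - Re lam / 2\<close>, the map from \<open>Z\<close> to the bounded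
  solution with forcing \<open>F A Z\<close> has the Lipschitz constant
  \<open>(L * nu / d + \<kappa>) / (- Re lam - d)\<close>, and \<open>gap\<close> says that this is at most one half.
\<close>

locale slow_fast =
  fixes lam :: complex and F :: "real \<Rightarrow> complex \<Rightarrow> complex" and nu R L \<kappa> :: real
  assumes decay: "Re lam < 0" and nu: "nu > 0" and L: "L \<ge> 0" and \<kappa>: "\<kappa> \<ge> 0"
    and F_bound: "norm z \<le> R \<Longrightarrow> norm (F a z) \<le> - Re lam * R"
    and F_Lipschitz: "norm y \<le> R \<Longrightarrow> norm z \<le> R \<Longrightarrow>
      norm (F a y - F b z) \<le> L * \<bar>a - b\<bar> + \<kappa> * norm (y - z)"
    and gap: "2 * L * nu / (- Re lam) + \<kappa> \<le> - Re lam / 4"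
begin

definition rate :: real where "rate = - Re lam"

text \<open>
  One step of the fixed-point iteration: from a candidate \<open>Z\<close> for the fast variable, \<open>A\<close> is the
  slow variable that it drives and \<open>W\<close> the bounded response of the linear equation to the resulting
  forcing. An orbit of the system that is bounded by \<open>R\<close> for all times is exactly a fixed point.
\<close>

definition slaved :: "(real \<Rightarrow> real) \<Rightarrow> (real \<Rightarrow> complex) \<Rightarrow> (real \<Rightarrow> complex) \<Rightarrow> bool" where
  "slaved A Z W \<longleftrightarrow>
     (\<forall>t. (A has_real_derivative nu * Re (Z t)) (at t)) \<and>
     (\<forall>t. (W has_vector_derivative lam * W t + F (A t) (Z t)) (at t)) \<and>
     (\<forall>t. norm (Z t) \<le> R) \<and> (\<forall>t. norm (W t) \<le> R)"

abbreviation bounded_orbit :: "(real \<Rightarrow> real) \<Rightarrow> (real \<Rightarrow> complex) \<Rightarrow> bool" where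
  "bounded_orbit A Z \<equiv> slaved A Z Z"

lemma rate_pos: "rate > 0"
  using decay by (simp add: rate_def)

lemma continuous_on_F:
  assumes A: "continuous_on UNIV A" and Z: "continuous_on UNIV Z" "\<And>t. norm (Z t) \<le> R"
  shows "continuous_on UNIV (\<lambda>t::real. F (A t) (Z t))"
  unfolding continuous_on_eq_continuous_at[OF open_UNIV]
proof (intro ballI)
  fix t :: real
  have "(A \<longlongrightarrow> A t) (at t)" "(Z \<longlongrightarrow> Z t) (at t)"
    using A Z(1) by (auto simp: continuous_on_eq_continuous_at isCont_def)
  then have "((\<lambda>s. L * \<bar>A s - A t\<bar> + \<kappa> * norm (Z s - Z t)) \<longlongrightarrow> L * \<bar>A t - A t\<bar> + \<kappa> * norm (Z t - Z t)) (at t)"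
    by (intro tendsto_intros)
  moreover have "L * \<bar>A t - A t\<bar> + \<kappa> * norm (Z t - Z t) = 0" by simp
  ultimately have lim: "((\<lambda>s. L * \<bar>A s - A t\<bar> + \<kappa> * norm (Z s - Z t)) \<longlongrightarrow> 0) (at t)" by metis
  have "\<forall>\<^sub>F s in at t. norm (F (A s) (Z s) - F (A t) (Z t)) \<le> L * \<bar>A s - A t\<bar> + \<kappa> * norm (Z s - Z t)"
    by (intro always_eventually allI F_Lipschitz Z)
  from Lim_null_comparison[OF this lim]
  show "isCont (\<lambda>t. F (A t) (Z t)) t"
    by (simp add: isCont_def LIM_zero_iff)
qed

lemma slaved_exists:
  assumes Z: "continuous_on UNIV Z" "\<And>t. norm (Z t) \<le> R"
  obtains A W where "slaved A Z W" "A 0 = a"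
proof -
  have "continuous_on UNIV (\<lambda>t. nu * Re (Z t))"
    by (intro continuous_intros Z)
  then obtain A where A: "\<And>t. (A has_vector_derivative nu * Re (Z t)) (at t)" "A 0 = a"
    using continuous_imp_antiderivative[of _ a] by metis
  have contA: "continuous_on UNIV A"
    by (meson A(1) continuous_at_imp_continuous_on has_vector_derivative_continuous)
  obtain W where W: "\<And>t. (W has_vector_derivative lam * W t + F (A t) (Z t)) (at t)"
      "\<And>t. norm (W t) \<le> - Re lam * R / (- Re lam)"
    by (rule linear_bounded_solution_exists[OF continuous_on_F[OF contA Z] F_bound[OF Z(2)] decay])
      blast
  show ?thesis
  proof
    show "slaved A Z W"
      using A W Z decay by (auto simp: slaved_def has_real_derivative_iff_has_vector_derivative)
  qed (rule A)
qed

lemma slow_variable_divergence: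
  assumes H: "\<And>t. (H has_real_derivative g t) (at t)"
    and g: "\<And>t. \<bar>g t\<bar> \<le> B * exp (d * \<bar>t\<bar>)" and "d > 0"
  shows "\<bar>H t\<bar> \<le> \<bar>H 0\<bar> + B / d * exp (d * \<bar>t\<bar>)"
proof -
  have "0 \<le> \<bar>g 0\<bar>" by simp
  also have "\<dots> \<le> B" using g[of 0] by simp
  finally have B: "B \<ge> 0" .
  have *: "\<bar>H t\<bar> \<le> \<bar>H 0\<bar> + B / d * exp (d * t)"
    if H: "\<And>t. (H has_real_derivative g t) (at t)"
    and g: "\<And>t. \<bar>g t\<bar> \<le> B * exp (d * \<bar>t\<bar>)" and t: "t \<ge> 0" for H g t
  proof -
    have "norm (H t - H 0) \<le> B / d * (exp (d * t) - exp (d * 0))"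
      using H g[of s for s] \<open>d > 0\<close> t
      by (intro exp_derivative_increment[where g = g])
        (auto simp flip: has_real_derivative_iff_has_vector_derivative intro: order_trans[OF g])
    also have "\<dots> \<le> B / d * exp (d * t)"
      using B \<open>d > 0\<close> by (intro mult_left_mono) auto
    finally show ?thesis by (simp add: abs_if split: if_splits)
  qed
  show ?thesis
  proof (cases "t \<ge> 0")
    case True
    then show ?thesis using *[OF H g] by simp
  next
    case False
    have "((\<lambda>t. H (- t)) has_real_derivative - g (- t)) (at t)" for t
      using H by (subst DERIV_mirror[symmetric]) auto
    from *[of "\<lambda>t. H (- t)" "\<lambda>t. - g (- t)" "- t", OF this] g[of "- s" for s] False
    show ?thesis by simp
  qed
qed

text \<open>
  The one estimate behind existence, uniqueness and Lipschitz dependence. For equal initial slow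
  variables it is a contraction by the factor one half in the norm with weight
  \<open>exp (rate / 2 * \<bar>t\<bar>)\<close>; the term with \<open>A 0 - A' 0\<close> measures how fixed points move with
  the initial slow variable.
\<close>

lemma slaved_difference_bound:
  assumes 1: "slaved A Z W" and 2: "slaved A' Z' W'"
    and diff: "\<And>t. norm (Z t - Z' t) \<le> m * exp (rate / 2 * \<bar>t\<bar>)"
  shows "norm (W t - W' t) \<le> (2 * L / rate * \<bar>A 0 - A' 0\<bar> + m / 2) * exp (rate / 2 * \<bar>t\<bar>)"
proof -
  define d where "d = rate / 2"
  define D where "D = \<bar>A 0 - A' 0\<bar>"
  have d: "d > 0" "rate - d = d" using rate_pos by (auto simp: d_def)
  have "0 \<le> norm (Z 0 - Z' 0)" by simp
  also have "\<dots> \<le> m" using diff[of 0] by simp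
  finally have m: "m \<ge> 0" .
  have e1: "1 \<le> exp (d * \<bar>t\<bar>)" for t using d by simp
  have A: "\<bar>A t - A' t\<bar> \<le> D + nu * m / d * exp (d * \<bar>t\<bar>)" for t
    unfolding D_def
  proof (rule slow_variable_divergence[OF _ _ d(1)])
    show "((\<lambda>t. A t - A' t) has_real_derivative nu * (Re (Z t - Z' t))) (at t)" for t
      using 1 2 by (auto simp: slaved_def algebra_simps intro!: derivative_eq_intros)
    fix t
    have "\<bar>nu * (Re (Z t - Z' t))\<bar> \<le> nu * norm (Z t - Z' t)"
      using nu abs_Re_le_cmod[of "Z t - Z' t"] by (simp add: abs_mult)
    also have "\<dots> \<le> nu * (m * exp (d * \<bar>t\<bar>))"
      using nu diff[of t] by (intro mult_left_mono) (auto simp: d_def)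
    finally show "\<bar>nu * (Re (Z t - Z' t))\<bar> \<le> nu * m * exp (d * \<bar>t\<bar>)" by simp
  qed
  define B where "B = L * D + (L * nu / d + \<kappa>) * m"
  have F: "norm (F (A t) (Z t) - F (A' t) (Z' t)) \<le> B * exp (d * \<bar>t\<bar>)" for t
  proof -
    have "norm (F (A t) (Z t) - F (A' t) (Z' t)) \<le> L * \<bar>A t - A' t\<bar> + \<kappa> * norm (Z t - Z' t)"
      using 1 2 by (intro F_Lipschitz) (auto simp: slaved_def)
    also have "\<dots> \<le> L * (D * exp (d * \<bar>t\<bar>) + nu * m / d * exp (d * \<bar>t\<bar>)) + \<kappa> * (m * exp (d * \<bar>t\<bar>))"
    proof (intro add_mono[OF mult_left_mono mult_left_mono] L \<kappa>)
      have "D * 1 \<le> D * exp (d * \<bar>t\<bar>)"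
        by (rule mult_left_mono[OF e1]) (simp add: D_def)
      then show "\<bar>A t - A' t\<bar> \<le> D * exp (d * \<bar>t\<bar>) + nu * m / d * exp (d * \<bar>t\<bar>)"
        using A[of t] by linarith
      show "norm (Z t - Z' t) \<le> m * exp (d * \<bar>t\<bar>)"
        using diff[of t] by (simp only: d_def)
    qed
    also have "\<dots> = B * exp (d * \<bar>t\<bar>)"
      by (simp add: B_def algebra_simps)
    finally show ?thesis .
  qed
  have "norm (W t - W' t) \<le> B / (- Re lam - d) * exp (d * \<bar>t\<bar>)"
  proof (rule linear_bounded_solution_weighted_bound)
    show "((\<lambda>t. W t - W' t) has_vector_derivative
        lam * (W t - W' t) + (F (A t) (Z t) - F (A' t) (Z' t))) (at t)" for t
      using 1 2 by (auto simp: slaved_def algebra_simps intro!: derivative_eq_intros)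
    show "norm (W t - W' t) \<le> R + R" for t
      using 1 2 by (intro order_trans[OF norm_triangle_ineq4] add_mono) (auto simp: slaved_def)
  qed (use F d in \<open>auto simp: rate_def\<close>)
  also have "B / (- Re lam - d) \<le> 2 * L / rate * D + m / 2"
  proof -
    have "(L * nu / d + \<kappa>) * m \<le> d / 2 * m"
      using gap m by (intro mult_right_mono) (auto simp: d_def rate_def mult_ac)
    then have "B \<le> L * D + d / 2 * m" by (simp add: B_def)
    then have "B / d \<le> (L * D + d / 2 * m) / d"
      using d by (intro divide_right_mono) auto
    also have "\<dots> = 2 * L / rate * D + m / 2"
    proof -
      have "rate = 2 * d" by (simp add: d_def)
      then show ?thesis using d(1) by (simp add: add_divide_distrib)
    qed
    finally show ?thesis using d unfolding rate_def by metis
  qed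
  finally show ?thesis by (simp add: D_def d_def mult_right_mono)
qed

text \<open>
  Banach's fixed point theorem for the iteration step, in the space of bounded continuous
  functions. The weighted norm becomes the supremum norm if the fast variable is written as
  \<open>w t * Y t\<close>; the bound \<open>R\<close> then cuts out a closed, hence complete, subset.
\<close>

lemma bounded_orbit_exists:
  assumes "R \<ge> 0"
  obtains A Z where "bounded_orbit A Z" "A 0 = a"
proof -
  define w where "w t = exp (rate / 2 * \<bar>t\<bar>)" for t :: real
  have w: "w t \<ge> 1" "w t > 0" for t using rate_pos by (auto simp: w_def)
  have w_cont: "continuous_on UNIV w"
    unfolding w_def by (intro continuous_intros)
  define S where "S = {Y :: real \<Rightarrow>\<^sub>C complex. \<forall>t. norm (complex_of_real (w t) * Y t) \<le> R}"
  have ex: "\<exists>Y'\<in>S. \<exists>A. A 0 = a \<and> slaved A (\<lambda>t. complex_of_real (w t) * Y t) (\<lambda>t. complex_of_real (w t) * Y' t)" if "Y \<in> S" for Y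
  proof -
    have "continuous_on UNIV (\<lambda>t. complex_of_real (w t) * Y t)"
      by (intro continuous_intros w_cont) auto
    moreover have "norm (complex_of_real (w t) * Y t) \<le> R" for t using that by (simp add: S_def)
    ultimately obtain A W where AW: "slaved A (\<lambda>t. complex_of_real (w t) * Y t) W" "A 0 = a"
      using slaved_exists by blast
    have W: "norm (W t) \<le> R" for t using AW by (auto simp: slaved_def)
    have "continuous_on UNIV W"
      using AW unfolding slaved_def
      by (meson continuous_at_imp_continuous_on has_vector_derivative_continuous)
    then have "continuous_on UNIV (\<lambda>t. W t / complex_of_real (w t))"
      using w(2) by (intro continuous_intros w_cont) (auto simp: less_le)
    moreover have "bounded (range (\<lambda>t. W t / complex_of_real (w t)))"
    proof (rule boundedI)
      fix x assume "x \<in> range (\<lambda>t. W t / complex_of_real (w t))"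
      then obtain t where "x = W t / complex_of_real (w t)" by auto
      moreover have "norm (W t) / w t \<le> R / 1"
        using W w[of t] \<open>R \<ge> 0\<close> by (intro frac_le) auto
      ultimately show "norm x \<le> R" using w(2)[of t] by (simp add: norm_divide)
    qed
    ultimately have "(\<lambda>t. W t / complex_of_real (w t)) \<in> bcontfun"
      by (simp add: bcontfun_def)
    then obtain Y' :: "real \<Rightarrow>\<^sub>C complex" where Y'_def: "(\<lambda>t. W t / complex_of_real (w t)) = Y'"
      by (rule bcontfunE)
    have "complex_of_real (w t) * Y' t = W t" for t
      using fun_cong[OF Y'_def, of t, symmetric] w(2)[of t] by simp
    then have Y': "(\<lambda>t. complex_of_real (w t) * Y' t) = W" by auto
    moreover have "Y' \<in> S"
      unfolding S_def using W fun_cong[OF Y'] by simp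
    ultimately show ?thesis using AW by (intro bexI[of _ Y'] exI[of _ A]) auto
  qed
  define succ where "succ Y Y' A \<longleftrightarrow> Y' \<in> S \<and> A 0 = a \<and>
      slaved A (\<lambda>t. complex_of_real (w t) * apply_bcontfun Y t)
        (\<lambda>t. complex_of_real (w t) * apply_bcontfun Y' t)" for Y Y' A
  have "\<forall>Y\<in>S. \<exists>YA. succ Y (fst YA) (snd YA)"
  proof
    fix Y assume "Y \<in> S"
    from ex[OF this] obtain Y' A where "succ Y Y' A" by (auto simp: succ_def)
    then show "\<exists>YA. succ Y (fst YA) (snd YA)" by (intro exI[of _ "(Y', A)"]) simp
  qed
  from bchoice[OF this] obtain N where "\<forall>Y\<in>S. succ Y (fst (N Y)) (snd (N Y))" by blast
  define T where "T Y = fst (N Y)" for Y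
  define A where "A Y = snd (N Y)" for Y
  have T: "T Y \<in> S" and A: "A Y 0 = a"
    "slaved (A Y) (\<lambda>t. complex_of_real (w t) * Y t) (\<lambda>t. complex_of_real (w t) * T Y t)"
    if "Y \<in> S" for Y
    using \<open>\<forall>Y\<in>S. succ Y (fst (N Y)) (snd (N Y))\<close> that by (auto simp: T_def A_def succ_def)
  have wd: "norm (complex_of_real (w t) * x - complex_of_real (w t) * y) = w t * dist x y" for t x y
    using w(2)[of t] by (simp add: dist_norm norm_mult flip: right_diff_distrib)
  have "\<exists>!Y\<in>S. T Y = Y"
  proof (rule Banach_fix[where c = "1/2"])
    have "closed {z. norm (complex_of_real (w t) * z) \<le> R}" for t
      by (intro closed_Collect_le continuous_intros)
    then have "closed (PiC UNIV (\<lambda>t. {z. norm (complex_of_real (w t) * z) \<le> R}))"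
      by (intro closed_PiC) auto
    moreover have "S = PiC UNIV (\<lambda>t. {z. norm (complex_of_real (w t) * z) \<le> R})"
      by (auto simp: S_def mem_PiC_iff Pi_iff)
    ultimately have "closed S" by simp
    then show "complete S" by (simp add: complete_eq_closed)
    have "const_bcontfun 0 \<in> S"
      using \<open>R \<ge> 0\<close> by (simp add: S_def const_bcontfun.rep_eq)
    then show "S \<noteq> {}" by auto
    show "T ` S \<subseteq> S" using T by auto
    fix X Y assume XY: "X \<in> S" "Y \<in> S"
    show "dist (T X) (T Y) \<le> 1/2 * dist X Y"
    proof (rule dist_bound)
      fix t
      have "norm (complex_of_real (w t) * T X t - complex_of_real (w t) * T Y t) \<le>
         (2 * L / rate * \<bar>A X 0 - A Y 0\<bar> + dist X Y / 2) * exp (rate / 2 * \<bar>t\<bar>)"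
      proof (rule slaved_difference_bound)
        fix t
        show "norm (complex_of_real (w t) * X t - complex_of_real (w t) * Y t) \<le> dist X Y * exp (rate / 2 * \<bar>t\<bar>)"
          unfolding wd using w(2)[of t] dist_bounded[of X t Y] by (simp add: w_def)
      qed (use A XY in auto)
      then have "w t * dist (T X t) (T Y t) \<le> w t * (dist X Y / 2)"
        unfolding wd using A XY by (simp add: w_def mult_ac)
      then show "dist (T X t) (T Y t) \<le> 1/2 * dist X Y"
        using w(2)[of t] by simp
    qed
  qed auto
  then obtain Y where "Y \<in> S" "T Y = Y" by blast
  have "bounded_orbit (A Y) (\<lambda>t. complex_of_real (w t) * Y t)"
    using A(2)[OF \<open>Y \<in> S\<close>] unfolding \<open>T Y = Y\<close> .
  then show ?thesis using A(1)[OF \<open>Y \<in> S\<close>] by (rule that)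
qed

text \<open>
  Both orbits are fixed points, so the contraction estimate can be applied to its own output over
  and over, starting from the trivial bound \<open>2 * R\<close>. For equal initial slow variables this also
  shows that the orbits coincide.
\<close>

lemma bounded_orbits_Lipschitz:
  assumes 1: "bounded_orbit A Z" and 2: "bounded_orbit A' Z'"
  shows "norm (Z 0 - Z' 0) \<le> 4 * L / rate * \<bar>A 0 - A' 0\<bar>"
proof -
  define c where "c = 2 * L / rate * \<bar>A 0 - A' 0\<bar>"
  have c: "c \<ge> 0" using L rate_pos by (simp add: c_def)
  \<comment> \<open>The map \<open>m \<mapsto> c + m / 2\<close> has the fixed point \<open>2 * c\<close>, to which the bounds converge.\<close>
  have *: "\<forall>t. norm (Z t - Z' t) \<le> (2 * c + 2 * R / 2 ^ n) * exp (rate / 2 * \<bar>t\<bar>)" for n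
  proof (induction n)
    case 0
    show ?case
    proof
      fix t
      have "norm (Z t - Z' t) \<le> R + R"
        using 1 2 by (intro order_trans[OF norm_triangle_ineq4] add_mono) (auto simp: slaved_def)
      also have "\<dots> \<le> (2 * c + 2 * R / 2 ^ 0) * 1" using c by simp
      also have "\<dots> \<le> (2 * c + 2 * R / 2 ^ 0) * exp (rate / 2 * \<bar>t\<bar>)"
      proof (rule mult_left_mono)
        have "0 \<le> R" using 1 norm_ge_zero order_trans unfolding slaved_def by blast
        then show "0 \<le> 2 * c + 2 * R / 2 ^ 0" using c by simp
      qed (use rate_pos in auto)
      finally show "norm (Z t - Z' t) \<le> (2 * c + 2 * R / 2 ^ 0) * exp (rate / 2 * \<bar>t\<bar>)" .
    qed
  next
    case (Suc n)
    show ?case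
    proof
      fix t
      have "norm (Z t - Z' t) \<le>
          (2 * L / rate * \<bar>A 0 - A' 0\<bar> + (2 * c + 2 * R / 2 ^ n) / 2) * exp (rate / 2 * \<bar>t\<bar>)"
        using Suc by (intro slaved_difference_bound[OF 1 2]) auto
      also have "2 * L / rate * \<bar>A 0 - A' 0\<bar> + (2 * c + 2 * R / 2 ^ n) / 2 = 2 * c + 2 * R / 2 ^ Suc n"
        unfolding c_def[symmetric] by (simp add: add_divide_distrib)
      finally show "norm (Z t - Z' t) \<le> (2 * c + 2 * R / 2 ^ Suc n) * exp (rate / 2 * \<bar>t\<bar>)" .
    qed
  qed
  have "(\<lambda>n. 2 * c + 2 * R / 2 ^ n) \<longlonglongrightarrow> 2 * c + 0"
    by (intro tendsto_intros LIMSEQ_divide_realpow_zero) auto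
  then have "norm (Z 0 - Z' 0) \<le> 2 * c + 0"
  proof (rule tendsto_lowerbound)
    show "\<forall>\<^sub>F n in sequentially. norm (Z 0 - Z' 0) \<le> 2 * c + 2 * R / 2 ^ n"
    proof (intro always_eventually allI)
      fix n
      show "norm (Z 0 - Z' 0) \<le> 2 * c + 2 * R / 2 ^ n"
        using *[of n] by (auto dest: spec[of _ 0])
    qed
  qed simp
  then show ?thesis by (simp add: c_def)
qed

lemma bounded_orbit_shift:
  assumes "bounded_orbit A Z"
  shows "bounded_orbit (\<lambda>t. A (\<tau> + t)) (\<lambda>t. Z (\<tau> + t))"
proof -
  have shift: "((\<lambda>t. f (\<tau> + t)) has_vector_derivative f') (at t)"
    if "(f has_vector_derivative f') (at (\<tau> + t))" for f :: "real \<Rightarrow> 'b::real_normed_vector" and f' t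
  proof -
    have "((\<lambda>t. \<tau> + t) has_vector_derivative 1) (at t)"
      unfolding has_real_derivative_iff_has_vector_derivative[symmetric]
      by (auto intro!: derivative_eq_intros)
    from vector_diff_chain_at[OF this that] show ?thesis by (simp add: o_def)
  qed
  show ?thesis
    unfolding slaved_def
  proof (intro conjI allI)
    fix t
    show "((\<lambda>t. A (\<tau> + t)) has_real_derivative nu * Re (Z (\<tau> + t))) (at t)"
      using assms unfolding slaved_def has_real_derivative_iff_has_vector_derivative
      by (intro shift) blast
    show "((\<lambda>t. Z (\<tau> + t)) has_vector_derivative
        lam * Z (\<tau> + t) + F (A (\<tau> + t)) (Z (\<tau> + t))) (at t)"
      using assms unfolding slaved_def by (intro shift) blast
    have "norm (Z (\<tau> + t)) \<le> R"
      using assms unfolding slaved_def by blast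
    then show "norm (Z (\<tau> + t)) \<le> R" "norm (Z (\<tau> + t)) \<le> R" by simp_all
  qed
qed

text \<open>
  The slow manifold is the graph of \<open>G a = Z 0\<close>, where \<open>(A, Z)\<close> is the bounded orbit with \<open>A 0 = a\<close>.
  It is invariant because a time shift of a bounded orbit is again one, and uniqueness identifies
  it with the orbit that starts at the shifted slow variable. On the graph the slow variable obeys a
  scalar autonomous equation with a Lipschitz right-hand side.
\<close>

theorem slow_manifold:
  assumes "R \<ge> 0"
  obtains G where "\<And>a b. norm (G a - G b) \<le> 4 * L / rate * \<bar>a - b\<bar>"
    and "\<And>a. \<exists>A Z. bounded_orbit A Z \<and> A 0 = a \<and> (\<forall>t. Z t = G (A t))"
proof -
  have "\<forall>a. \<exists>p. bounded_orbit (fst p) (snd p) \<and> fst p 0 = a"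
  proof
    fix a
    obtain A Z where "bounded_orbit A Z" "A 0 = a"
      by (rule bounded_orbit_exists[OF assms, of a])
    then show "\<exists>p. bounded_orbit (fst p) (snd p) \<and> fst p 0 = a"
      by (intro exI[of _ "(A, Z)"]) simp
  qed
  from choice[OF this] obtain N
    where N: "\<forall>a. bounded_orbit (fst (N a)) (snd (N a)) \<and> fst (N a) 0 = a" by blast
  define A where "A a = fst (N a)" for a
  define Z where "Z a = snd (N a)" for a
  have AZ: "bounded_orbit (A a) (Z a)" "A a 0 = a" for a
    using N by (auto simp: A_def Z_def)
  define G where "G a = Z a 0" for a
  show ?thesis
  proof
    show "norm (G a - G b) \<le> 4 * L / rate * \<bar>a - b\<bar>" for a b
      using bounded_orbits_Lipschitz[OF AZ(1) AZ(1), of a b] by (simp add: G_def AZ)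
    have "Z a t = G (A a t)" for a t
      using bounded_orbits_Lipschitz[OF bounded_orbit_shift[OF AZ(1), of a t] AZ(1)[of "A a t"]]
      by (simp add: G_def AZ)
    then show "\<exists>A Z. bounded_orbit A Z \<and> A 0 = a \<and> (\<forall>t. Z t = G (A t))" for a
      using AZ by (intro exI[of _ "A a"] exI[of _ "Z a"]) simp
  qed
qed

end

section \<open>Orbits connecting the ends of the slow manifold\<close>

lemma autonomous_flow_at_top:
  fixes f A :: "real \<Rightarrow> real"
  assumes A: "\<And>t. (A has_real_derivative f (A t)) (at t)"
    and cont: "continuous_on UNIV f" and pos: "\<And>a. f a > 0"
  shows "filterlim A at_top at_top"
proof -
  have mono: "A r \<le> A t" if "r \<le> t" for r t
    using that by (rule DERIV_nonneg_imp_nondecreasing) (use A pos less_imp_le in blast)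
  have "\<exists>t. b \<le> A t" for b
  proof (cases "A 0 \<le> b")
    case True
    have "\<exists>y\<in>{A 0..b}. \<forall>a\<in>{A 0..b}. f y \<le> f a"
      using True by (intro continuous_attains_inf continuous_on_subset[OF cont]) auto
    then obtain y where y: "\<And>a. A 0 \<le> a \<Longrightarrow> a \<le> b \<Longrightarrow> f y \<le> f a"
      by (meson atLeastAtMost_iff)
    define m where "m = f y"
    have m: "m > 0" "\<And>a. A 0 \<le> a \<Longrightarrow> a \<le> b \<Longrightarrow> m \<le> f a"
      using pos y by (simp_all add: m_def)
    \<comment> \<open>Below \<open>b\<close> the speed is at least \<open>m\<close>, so \<open>b\<close> is reached by this time.\<close>
    define t where "t = (b - A 0) / m + 1"
    have t: "t > 0" "m * t \<ge> b - A 0"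
      using m True by (auto simp: t_def field_simps add_pos_nonneg)
    show ?thesis
    proof (rule ccontr)
      assume "\<nexists>t. b \<le> A t"
      then have lt: "A t < b" for t by (simp add: not_le)
      obtain z where z: "0 < z" "z < t" "A t - A 0 = (t - 0) * f (A z)"
        using MVT2[OF t(1), of A "\<lambda>t. f (A t)"] A by blast
      have "m \<le> f (A z)" using mono[of 0 z] lt[of z] z by (intro m) auto
      then have "m * t \<le> A t - A 0" using z t by (simp add: mult.commute)
      with lt[of t] t(2) show False by simp
    qed
  qed (use linear in blast)
  then show ?thesis
    unfolding filterlim_at_top eventually_at_top_linorder by (meson mono order_trans)
qed

lemma autonomous_flow_connects:
  fixes f A :: "real \<Rightarrow> real"
  assumes A: "\<And>t. (A has_real_derivative f (A t)) (at t)"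
    and cont: "continuous_on UNIV f" and nz: "\<And>a. f a \<noteq> 0"
  shows "(filterlim A at_bot at_bot \<and> filterlim A at_top at_top) \<or>
         (filterlim A at_top at_bot \<and> filterlim A at_bot at_top)"
proof -
  have *: "filterlim A at_bot at_bot \<and> filterlim A at_top at_top"
    if A: "\<And>t. (A has_real_derivative f (A t)) (at t)"
    and cont: "continuous_on UNIV f" and pos: "\<And>a. f a > 0" for A f :: "real \<Rightarrow> real"
  proof
    show "filterlim A at_top at_top" by (rule autonomous_flow_at_top[OF A cont pos])
    have "filterlim (\<lambda>t. - A (- t)) at_top at_top"
    proof (rule autonomous_flow_at_top)
      show "((\<lambda>t. - A (- t)) has_real_derivative f (- (- A (- t)))) (at t)" for t
        by (auto intro!: derivative_eq_intros DERIV_chain'[OF _ A])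
      show "continuous_on UNIV (\<lambda>a. f (- a))"
        by (intro continuous_on_compose2[OF cont] continuous_intros) auto
    qed (rule pos)
    then show "filterlim A at_bot at_bot"
      by (simp add: filterlim_uminus_at_top filterlim_at_bot_mirror)
  qed
  have "(\<forall>a. f a > 0) \<or> (\<forall>a. f a < 0)"
  proof (rule ccontr)
    assume "\<not> ?thesis"
    then obtain a b where ab: "f a \<le> 0" "f b \<ge> 0" by (auto simp: not_less)
    have "connected (range f)"
      by (intro connected_continuous_image cont) auto
    then have "0 \<in> range f"
      using ab by (meson connected_contains_Icc atLeastAtMost_iff rangeI subsetD)
    then show False using nz by auto
  qed
  then show ?thesis
  proof
    assume "\<forall>a. f a > 0"
    then show ?thesis using *[OF A cont] by blast
  next
    assume neg: "\<forall>a. f a < 0"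
    have "filterlim (\<lambda>t. - A t) at_bot at_bot \<and> filterlim (\<lambda>t. - A t) at_top at_top"
    proof (rule *)
      show "((\<lambda>t. - A t) has_real_derivative - f (- (- A t))) (at t)" for t
        by (auto intro!: derivative_eq_intros A)
      show "continuous_on UNIV (\<lambda>a. - f (- a))"
        by (intro continuous_on_minus continuous_on_compose2[OF cont] continuous_intros) auto
    qed (use neg in auto)
    then have "filterlim A at_top at_bot" "filterlim A at_bot at_top"
      using filterlim_uminus_at_top[of A at_bot] filterlim_uminus_at_bot[of A at_top] by blast+
    then show ?thesis by blast
  qed
qed

text \<open>
  Gronwall's inequality for \<open>(A t - A 0)\<^sup>2\<close>, written as monotonicity of
  \<open>exp (- 2 * K * t) * (A t - A 0)\<^sup>2\<close>.
\<close>

lemma autonomous_flow_stationary: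
  fixes f A :: "real \<Rightarrow> real"
  assumes A: "\<And>t. (A has_real_derivative f (A t)) (at t)"
    and lip: "\<And>a b. \<bar>f a - f b\<bar> \<le> K * \<bar>a - b\<bar>" and zero: "f (A 0) = 0" and "t \<ge> 0"
  shows "A t = A 0"
proof -
  define v where "v t = exp (- 2 * K * t) * (A t - A 0)\<^sup>2" for t
  have "v t \<le> v 0"
  proof (rule DERIV_nonpos_imp_nonincreasing[OF \<open>t \<ge> 0\<close>])
    fix s
    have "(v has_real_derivative exp (- 2 * K * s) * (2 * ((A s - A 0) * f (A s) - K * (A s - A 0)\<^sup>2))) (at s)"
      unfolding v_def by (auto intro!: derivative_eq_intros A simp: algebra_simps power2_eq_square)
    moreover have "(A s - A 0) * f (A s) \<le> \<bar>A s - A 0\<bar> * \<bar>f (A s)\<bar>"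
      by (metis abs_ge_self abs_mult)
    moreover have "\<dots> \<le> \<bar>A s - A 0\<bar> * (K * \<bar>A s - A 0\<bar>)"
      using lip[of "A s" "A 0"] zero by (intro mult_left_mono) auto
    moreover have "\<dots> = K * (A s - A 0)\<^sup>2"
      by (simp add: power2_eq_square abs_mult_self_eq mult.left_commute)
    ultimately show "\<exists>y. (v has_real_derivative y) (at s) \<and> y \<le> 0"
      by (intro exI conjI) (auto simp: mult_nonneg_nonpos)
  qed
  then have "exp (- 2 * K * t) * (A t - A 0)\<^sup>2 \<le> 0" by (simp add: v_def)
  then show ?thesis by (simp add: mult_le_0_iff)
qed

context slow_fast
begin

text \<open>
  On the slow manifold a zero \<open>a\<close> of the slow speed \<open>nu * Re (G a)\<close> is a rest point of the whole
  system: the slow variable stays at \<open>a\<close>, hence the fast variable stays at \<open>G a\<close>. Excluding rest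
  points therefore gives the slow speed a fixed sign. It may still tend to zero as \<open>a\<close> tends to \<open>\<plusminus>\<infinity>\<close>.
\<close>

theorem connecting_orbit:
  assumes "R \<ge> 0" and no_equilibrium: "\<And>a z. norm z \<le> R \<Longrightarrow> Re z = 0 \<Longrightarrow> lam * z + F a z \<noteq> 0"
  obtains A Z where "bounded_orbit A Z"
    and "(filterlim A at_bot at_bot \<and> filterlim A at_top at_top) \<or>
         (filterlim A at_top at_bot \<and> filterlim A at_bot at_top)"
proof -
  obtain G where lip: "\<And>a b. norm (G a - G b) \<le> 4 * L / rate * \<bar>a - b\<bar>"
    and G: "\<And>a. \<exists>A Z. bounded_orbit A Z \<and> A 0 = a \<and> (\<forall>t. Z t = G (A t))"
    using slow_manifold[OF assms(1)] by blast
  define f where "f a = nu * Re (G a)" for a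
  define K where "K = nu * (4 * L / rate)"
  have f_lip: "\<bar>f a - f b\<bar> \<le> K * \<bar>a - b\<bar>" for a b
  proof -
    have "\<bar>f a - f b\<bar> = nu * \<bar>Re (G a - G b)\<bar>"
      using nu by (simp add: f_def abs_mult flip: right_diff_distrib)
    also have "\<dots> \<le> nu * norm (G a - G b)"
      using nu by (intro mult_left_mono abs_Re_le_cmod) simp
    also have "\<dots> \<le> nu * (4 * L / rate * \<bar>a - b\<bar>)"
      using nu lip by (intro mult_left_mono) auto
    finally show ?thesis by (simp add: K_def)
  qed
  have A_deriv: "(A has_real_derivative f (A t)) (at t)"
    if "bounded_orbit A Z" "\<forall>t. Z t = G (A t)" for A Z t
    using that by (simp add: slaved_def f_def)
  have nz: "f a \<noteq> 0" for a
  proof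
    assume "f a = 0"
    obtain A Z where AZ: "bounded_orbit A Z" "A 0 = a" "\<forall>t. Z t = G (A t)" using G by blast
    have const: "A t = a" if "t \<ge> 0" for t
      using autonomous_flow_stationary[OF A_deriv[OF AZ(1,3)] f_lip _ that] \<open>f a = 0\<close> AZ(2) by simp
    have "(Z has_vector_derivative lam * Z 1 + F (A 1) (Z 1)) (at 1)"
      using AZ by (simp add: slaved_def)
    moreover have "(Z has_vector_derivative 0) (at 1)"
    proof (rule has_vector_derivative_transform_within_open[where S = "{0<..}"])
      show "((\<lambda>t. G a) has_vector_derivative 0) (at 1)" by simp
    qed (use AZ const in auto)
    ultimately have "lam * Z 1 + F (A 1) (Z 1) = 0"
      by (rule vector_derivative_unique_at)
    moreover have "Re (Z 1) = 0" using \<open>f a = 0\<close> nu AZ const[of 1] by (simp add: f_def)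
    moreover have "norm (Z 1) \<le> R" using AZ by (simp add: slaved_def)
    ultimately show False using no_equilibrium by blast
  qed
  have cont: "continuous_on UNIV f"
    unfolding continuous_on_eq_continuous_at[OF open_UNIV]
  proof
    fix a
    have "((\<lambda>b. K * \<bar>b - a\<bar>) \<longlongrightarrow> K * \<bar>a - a\<bar>) (at a)"
      by (intro tendsto_intros)
    moreover have "K * \<bar>a - a\<bar> = 0" by simp
    ultimately have lim: "((\<lambda>b. K * \<bar>b - a\<bar>) \<longlongrightarrow> 0) (at a)" by metis
    have "\<forall>\<^sub>F b in at a. norm (f b - f a) \<le> K * \<bar>b - a\<bar>"
      unfolding real_norm_def by (intro always_eventually allI f_lip)
    from Lim_null_comparison[OF this lim]
    show "isCont f a" by (simp add: isCont_def LIM_zero_iff)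
  qed
  obtain A Z where AZ: "bounded_orbit A Z" "\<forall>t. Z t = G (A t)" using G by blast
  with autonomous_flow_connects[OF A_deriv[OF AZ] cont nz] that show ?thesis by blast
qed

end

section \<open>The equation in the moving frame\<close>

text \<open>
  Together with \<open>polar \<phi> \<theta>\<close>, the vectors below form the right-handed orthonormal frame of spherical
  coordinates. In this frame the equation splits into its two tangential components.
\<close>

definition e_theta :: "real \<Rightarrow> real \<Rightarrow> real^3" where
  "e_theta \<phi> \<theta> = vector [cos \<phi> * cos \<theta>, sin \<phi> * cos \<theta>, - sin \<theta>]"

definition e_phi :: "real \<Rightarrow> real^3" where
  "e_phi \<phi> = vector [- sin \<phi>, cos \<phi>, 0]"

lemmas frame_defs = polar_def e_theta_def e_phi_def e3_def

lemma vector_3_axis: "(vector [a, b, c] :: real^3) = a *\<^sub>R axis 1 1 + b *\<^sub>R axis 2 1 + c *\<^sub>R axis 3 1"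
  by (simp add: vec_eq_iff forall_3 axis_def)

lemma has_vector_derivative_vector_3:
  assumes "(a has_real_derivative a') (at t)" "(b has_real_derivative b') (at t)"
    "(c has_real_derivative c') (at t)"
  shows "((\<lambda>t. vector [a t, b t, c t] :: real^3) has_vector_derivative vector [a', b', c']) (at t)"
  unfolding vector_3_axis using assms
  by (intro has_vector_derivative_add has_vector_derivative_scaleR[OF _ has_vector_derivative_const, simplified])

lemma continuous_on_vector_3:
  assumes "continuous_on S a" "continuous_on S b" "continuous_on S c"
  shows "continuous_on S (\<lambda>t. vector [a t, b t, c t] :: real^3)"
  unfolding vector_3_axis by (intro continuous_intros assms)

lemma norm_polar: "norm (polar \<phi> \<theta>) = 1"
proof -
  have "(cos \<phi> * sin \<theta>)\<^sup>2 + (sin \<phi> * sin \<theta>)\<^sup>2 + (cos \<theta>)\<^sup>2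
      = ((cos \<phi>)\<^sup>2 + (sin \<phi>)\<^sup>2) * (sin \<theta>)\<^sup>2 + (cos \<theta>)\<^sup>2"
    by (simp only: power_mult_distrib distrib_right)
  also have "\<dots> = 1" by (simp add: add.commute)
  finally show ?thesis
    by (simp add: norm_eq_sqrt_inner inner_vec_def sum_3 polar_def flip: power2_eq_square)
qed

lemma polar_third: "polar \<phi> \<theta> $ 3 = cos \<theta>"
  by (simp add: polar_def)

lemma e3_frame: "e3 = cos \<theta> *\<^sub>R polar \<phi> \<theta> - sin \<theta> *\<^sub>R e_theta \<phi> \<theta>"
  by (simp add: vec_eq_iff forall_3 frame_defs axis_def sin_cos_squared_add3)

lemma cross3_polar_e_theta: "cross3 (polar \<phi> \<theta>) (e_theta \<phi> \<theta>) = e_phi \<phi>"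
proof -
  have "cos \<theta> * (cos \<phi> * cos \<theta>) + sin \<theta> * (cos \<phi> * sin \<theta>) = cos \<phi> * ((cos \<theta>)\<^sup>2 + (sin \<theta>)\<^sup>2)"
    "cos \<theta> * (sin \<phi> * cos \<theta>) + sin \<theta> * (sin \<phi> * sin \<theta>) = sin \<phi> * ((cos \<theta>)\<^sup>2 + (sin \<theta>)\<^sup>2)"
    by algebra+
  then show ?thesis
    by (simp add: cross3_def vec_eq_iff forall_3 frame_defs algebra_simps)
qed

lemma cross3_polar_e_phi: "cross3 (polar \<phi> \<theta>) (e_phi \<phi>) = - e_theta \<phi> \<theta>"
proof -
  have "cos \<phi> * sin \<theta> * cos \<phi> + sin \<phi> * sin \<theta> * sin \<phi> = sin \<theta> * ((cos \<phi>)\<^sup>2 + (sin \<phi>)\<^sup>2)"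
    by algebra
  then show ?thesis
    by (simp add: cross3_def vec_eq_iff forall_3 frame_defs algebra_simps)
qed

lemma cross3_polar_frame:
  "cross3 (polar \<phi> \<theta>) (a *\<^sub>R e_theta \<phi> \<theta> + b *\<^sub>R e_phi \<phi> + d *\<^sub>R polar \<phi> \<theta>)
     = a *\<^sub>R e_phi \<phi> - b *\<^sub>R e_theta \<phi> \<theta>"
  by (simp add: cross_add_right cross_mult_right cross3_polar_e_theta cross3_polar_e_phi)

lemma
  assumes \<phi>: "(\<phi> has_real_derivative \<phi>') (at t)" and \<theta>: "(\<theta> has_real_derivative \<theta>') (at t)"
  shows polar_has_vector_derivative:
      "((\<lambda>t. polar (\<phi> t) (\<theta> t)) has_vector_derivative
         \<theta>' *\<^sub>R e_theta (\<phi> t) (\<theta> t) + (sin (\<theta> t) * \<phi>') *\<^sub>R e_phi (\<phi> t)) (at t)"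
    and e_theta_has_vector_derivative:
      "((\<lambda>t. e_theta (\<phi> t) (\<theta> t)) has_vector_derivative
         (- \<theta>') *\<^sub>R polar (\<phi> t) (\<theta> t) + (cos (\<theta> t) * \<phi>') *\<^sub>R e_phi (\<phi> t)) (at t)"
    and e_phi_has_vector_derivative:
      "((\<lambda>t. e_phi (\<phi> t)) has_vector_derivative
         (- \<phi>' * sin (\<theta> t)) *\<^sub>R polar (\<phi> t) (\<theta> t) + (- \<phi>' * cos (\<theta> t)) *\<^sub>R e_theta (\<phi> t) (\<theta> t)) (at t)"
proof -
  note cong = has_vector_derivative_eq_rhs[OF has_vector_derivative_vector_3]
  note d = derivative_eq_intros \<phi> \<theta>
  show "((\<lambda>t. polar (\<phi> t) (\<theta> t)) has_vector_derivative
         \<theta>' *\<^sub>R e_theta (\<phi> t) (\<theta> t) + (sin (\<theta> t) * \<phi>') *\<^sub>R e_phi (\<phi> t)) (at t)"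
    unfolding polar_def
    by (rule cong, (rule d refl)+) (simp add: vec_eq_iff forall_3 frame_defs algebra_simps)
  show "((\<lambda>t. e_theta (\<phi> t) (\<theta> t)) has_vector_derivative
         (- \<theta>') *\<^sub>R polar (\<phi> t) (\<theta> t) + (cos (\<theta> t) * \<phi>') *\<^sub>R e_phi (\<phi> t)) (at t)"
    unfolding e_theta_def
    by (rule cong, (rule d refl)+) (simp add: vec_eq_iff forall_3 frame_defs algebra_simps)
  have "\<phi>' * cos (\<phi> t) * (cos (\<theta> t))\<^sup>2 + \<phi>' * cos (\<phi> t) * (sin (\<theta> t))\<^sup>2 = \<phi>' * cos (\<phi> t)"
    "\<phi>' * sin (\<phi> t) * (cos (\<theta> t))\<^sup>2 + \<phi>' * sin (\<phi> t) * (sin (\<theta> t))\<^sup>2 = \<phi>' * sin (\<phi> t)"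
    by (simp_all flip: distrib_left)
  then show "((\<lambda>t. e_phi (\<phi> t)) has_vector_derivative
         (- \<phi>' * sin (\<theta> t)) *\<^sub>R polar (\<phi> t) (\<theta> t) + (- \<phi>' * cos (\<theta> t)) *\<^sub>R e_theta (\<phi> t) (\<theta> t)) (at t)"
    unfolding e_phi_def
    by (intro cong) ((rule d refl)+, simp add: vec_eq_iff forall_3 frame_defs algebra_simps power2_eq_square)
qed

text \<open>
  The cross product with \<open>m\<close> from the left sends \<open>e_theta\<close> to \<open>e_phi\<close> and \<open>e_phi\<close> to \<open>- e_theta\<close>. Writing \<open>m_t\<close> as
  \<open>T1 * e_theta + T2 * e_phi\<close> and the tangential part of \<open>m_xx\<close> as \<open>X1 * e_theta + X2 * e_phi\<close>, the
  equation reads \<open>T2 = \<alpha> * T1 - X1 - (\<mu> * cos \<theta> - h) * sin \<theta>\<close> and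
  \<open>- T1 = \<alpha> * T2 - X2 - beta_bar \<beta> c \<theta> * sin \<theta>\<close>; these are the two profile equations. The
  second one is kept multiplied by \<open>sin \<theta>\<close>, which avoids the coordinate singularity.
\<close>

lemma travelling_profile_solves_llgs:
  fixes \<phi> \<theta> p q p' q' :: "real \<Rightarrow> real"
  assumes \<theta>: "\<And>\<xi>. (\<theta> has_real_derivative p \<xi>) (at \<xi>)"
    and \<phi>: "\<And>\<xi>. (\<phi> has_real_derivative q \<xi>) (at \<xi>)"
    and p: "\<And>\<xi>. (p has_real_derivative p' \<xi>) (at \<xi>)"
    and q: "\<And>\<xi>. (q has_real_derivative q' \<xi>) (at \<xi>)"
    and cont: "continuous_on UNIV p'" "continuous_on UNIV q'"
    and ode_p: "\<And>\<xi>. p' \<xi> = sin (\<theta> \<xi>) * (h + ((q \<xi>)\<^sup>2 - \<mu>) * cos (\<theta> \<xi>) - (\<Omega> - s * q \<xi>)) - \<alpha> * s * p \<xi>"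
    and ode_q: "\<And>\<xi>. sin (\<theta> \<xi>) * q' \<xi> = sin (\<theta> \<xi>) * (\<alpha> * (\<Omega> - s * q \<xi>) - beta_bar \<beta> c (\<theta> \<xi>))
                  - (s + 2 * cos (\<theta> \<xi>) * q \<xi>) * p \<xi>"
  shows "llgs_solution \<alpha> \<beta> c h \<mu> (\<lambda>x t. polar (\<phi> (x - s * t) + \<Omega> * t) (\<theta> (x - s * t)))"
proof -
  define et where "et x t = e_theta (\<phi> (x - s * t) + \<Omega> * t) (\<theta> (x - s * t))" for x t
  define ep where "ep x t = e_phi (\<phi> (x - s * t) + \<Omega> * t)" for x t
  define m where "m x t = polar (\<phi> (x - s * t) + \<Omega> * t) (\<theta> (x - s * t))" for x t
  define T1 where "T1 \<xi> = - s * p \<xi>" for \<xi>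
  define T2 where "T2 \<xi> = sin (\<theta> \<xi>) * (\<Omega> - s * q \<xi>)" for \<xi>
  define X1 where "X1 \<xi> = p' \<xi> - sin (\<theta> \<xi>) * cos (\<theta> \<xi>) * (q \<xi>)\<^sup>2" for \<xi>
  define X2 where "X2 \<xi> = sin (\<theta> \<xi>) * q' \<xi> + 2 * cos (\<theta> \<xi>) * p \<xi> * q \<xi>" for \<xi>
  define X3 where "X3 \<xi> = - (p \<xi>)\<^sup>2 - (sin (\<theta> \<xi>))\<^sup>2 * (q \<xi>)\<^sup>2" for \<xi>
  define mt where "mt x t = T1 (x - s * t) *\<^sub>R et x t + T2 (x - s * t) *\<^sub>R ep x t" for x t
  define mx where "mx x t = p (x - s * t) *\<^sub>R et x t + (sin (\<theta> (x - s * t)) * q (x - s * t)) *\<^sub>R ep x t" for x t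
  define mxx where "mxx x t = X1 (x - s * t) *\<^sub>R et x t + X2 (x - s * t) *\<^sub>R ep x t + X3 (x - s * t) *\<^sub>R m x t" for x t
  have in_x: "((\<lambda>x. f (x - s * t)) has_real_derivative f') (at x)"
    if f: "(f has_real_derivative f') (at (x - s * t))" for f f' x t
  proof -
    have "((\<lambda>x. x - s * t) has_real_derivative 1) (at x)"
      by (auto intro!: derivative_eq_intros)
    from DERIV_chain2[OF f this] show ?thesis by simp
  qed
  have in_t: "((\<lambda>t. f (x - s * t)) has_real_derivative - s * f') (at t)"
    if f: "(f has_real_derivative f') (at (x - s * t))" for f f' x t
  proof -
    have "((\<lambda>t. x - s * t) has_real_derivative - s) (at t)"
      by (auto intro!: derivative_eq_intros)
    from DERIV_chain2[OF f this] show ?thesis by (simp add: mult.commute)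
  qed
  have dt: "((\<lambda>\<tau>. m x \<tau>) has_vector_derivative mt x t) (at t)" for x t
  proof -
    have "((\<lambda>t. \<phi> (x - s * t) + \<Omega> * t) has_real_derivative \<Omega> - s * q (x - s * t)) (at t)"
      using in_t[OF \<phi>] by (auto intro!: derivative_eq_intros)
    from polar_has_vector_derivative[OF this in_t[OF \<theta>]]
    show ?thesis by (simp add: m_def mt_def et_def ep_def T1_def T2_def)
  qed
  have \<phi>x: "((\<lambda>x. \<phi> (x - s * t) + \<Omega> * t) has_real_derivative q (x - s * t)) (at x)" for x t
    using in_x[OF \<phi>] by (auto intro!: derivative_eq_intros)
  note frame_x = polar_has_vector_derivative[OF \<phi>x in_x[OF \<theta>]]
    e_theta_has_vector_derivative[OF \<phi>x in_x[OF \<theta>]] e_phi_has_vector_derivative[OF \<phi>x in_x[OF \<theta>]]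
  have dx: "((\<lambda>y. m y t) has_vector_derivative mx x t) (at x)" for x t
    using frame_x(1) by (simp add: m_def mx_def et_def ep_def)
  have dxx: "((\<lambda>y. mx y t) has_vector_derivative mxx x t) (at x)" for x t
  proof -
    let ?\<xi> = "x - s * t"
    have "((\<lambda>x. sin (\<theta> (x - s * t)) * q (x - s * t)) has_real_derivative
        cos (\<theta> ?\<xi>) * p ?\<xi> * q ?\<xi> + sin (\<theta> ?\<xi>) * q' ?\<xi>) (at x)"
      using in_x[OF \<theta>] in_x[OF q] by (auto intro!: derivative_eq_intros)
    from has_vector_derivative_add[OF has_vector_derivative_scaleR[OF in_x[OF p] frame_x(2)]
        has_vector_derivative_scaleR[OF this frame_x(3)]]
    have "((\<lambda>y. mx y t) has_vector_derivative
       p ?\<xi> *\<^sub>R ((- p ?\<xi>) *\<^sub>R m x t + (cos (\<theta> ?\<xi>) * q ?\<xi>) *\<^sub>R ep x t) + p' ?\<xi> *\<^sub>R et x t +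
       ((sin (\<theta> ?\<xi>) * q ?\<xi>) *\<^sub>R ((- q ?\<xi> * sin (\<theta> ?\<xi>)) *\<^sub>R m x t + (- q ?\<xi> * cos (\<theta> ?\<xi>)) *\<^sub>R et x t) +
        (cos (\<theta> ?\<xi>) * p ?\<xi> * q ?\<xi> + sin (\<theta> ?\<xi>) * q' ?\<xi>) *\<^sub>R ep x t)) (at x)"
      by (simp only: mx_def m_def et_def ep_def)
    then show ?thesis
      by (rule has_vector_derivative_eq_rhs)
        (simp add: mxx_def X1_def X2_def X3_def vec_eq_iff algebra_simps power2_eq_square)
  qed
  have cont1: "continuous_on UNIV \<theta>" "continuous_on UNIV \<phi>" "continuous_on UNIV p" "continuous_on UNIV q"
    using \<theta> \<phi> p q by (auto intro!: DERIV_continuous_on)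
  have comp: "continuous_on UNIV (\<lambda>z::real \<times> real. f (fst z - s * snd z))"
    if "continuous_on UNIV f" for f :: "real \<Rightarrow> real"
    by (intro continuous_on_compose2[OF that] continuous_intros) auto
  note cont_intros = continuous_on_vector_3 continuous_intros comp[OF cont1(1)] comp[OF cont1(2)]
     comp[OF cont1(3)] comp[OF cont1(4)] comp[OF cont(1)] comp[OF cont(2)]
  have cont_mt: "continuous_on UNIV (\<lambda>(x, t). mt x t)"
    unfolding case_prod_unfold mt_def et_def ep_def T1_def T2_def e_theta_def e_phi_def
    by (intro cont_intros)
  have cont_mxx: "continuous_on UNIV (\<lambda>(x, t). mxx x t)"
    unfolding case_prod_unfold mxx_def m_def et_def ep_def X1_def X2_def X3_def
      polar_def e_theta_def e_phi_def
    by (intro cont_intros)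
  have eq: "mt x t = cross3 (m x t)
      (\<alpha> *\<^sub>R mt x t - mxx x t + (\<mu> * m x t $ 3 - h) *\<^sub>R e3
       + (\<beta> / (1 + c * m x t $ 3)) *\<^sub>R cross3 (m x t) e3)" for x t
  proof -
    define \<xi> where "\<xi> = x - s * t"
    let ?b = "beta_bar \<beta> c (\<theta> \<xi>)"
    have m3: "m x t $ 3 = cos (\<theta> \<xi>)" by (simp add: m_def polar_third \<xi>_def)
    have e3: "e3 = cos (\<theta> \<xi>) *\<^sub>R m x t - sin (\<theta> \<xi>) *\<^sub>R et x t"
      unfolding m_def et_def \<xi>_def by (rule e3_frame)
    have cr: "cross3 (m x t) (a *\<^sub>R et x t + b *\<^sub>R ep x t + d *\<^sub>R m x t) = a *\<^sub>R ep x t - b *\<^sub>R et x t" for a b d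
      unfolding m_def et_def ep_def by (rule cross3_polar_frame)
    have me3: "cross3 (m x t) e3 = - sin (\<theta> \<xi>) *\<^sub>R ep x t"
      using cr[of "- sin (\<theta> \<xi>)" 0 "cos (\<theta> \<xi>)"] by (simp add: e3)
    have b: "\<beta> / (1 + c * cos (\<theta> \<xi>)) = ?b" by (simp add: beta_bar_def)
    have "\<alpha> *\<^sub>R mt x t - mxx x t + (\<mu> * m x t $ 3 - h) *\<^sub>R e3
       + (\<beta> / (1 + c * m x t $ 3)) *\<^sub>R cross3 (m x t) e3 =
      (\<alpha> * T1 \<xi> - X1 \<xi> - (\<mu> * cos (\<theta> \<xi>) - h) * sin (\<theta> \<xi>)) *\<^sub>R et x t
      + (\<alpha> * T2 \<xi> - X2 \<xi> - ?b * sin (\<theta> \<xi>)) *\<^sub>R ep x t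
      + ((\<mu> * cos (\<theta> \<xi>) - h) * cos (\<theta> \<xi>) - X3 \<xi>) *\<^sub>R m x t"
      unfolding me3 m3 b mt_def mxx_def \<xi>_def[symmetric]
      by (simp add: e3 vec_eq_iff algebra_simps)
    also have "cross3 (m x t) \<dots> =
       (\<alpha> * T1 \<xi> - X1 \<xi> - (\<mu> * cos (\<theta> \<xi>) - h) * sin (\<theta> \<xi>)) *\<^sub>R ep x t
        - (\<alpha> * T2 \<xi> - X2 \<xi> - ?b * sin (\<theta> \<xi>)) *\<^sub>R et x t"
      by (rule cr)
    also have "\<alpha> * T1 \<xi> - X1 \<xi> - (\<mu> * cos (\<theta> \<xi>) - h) * sin (\<theta> \<xi>) = T2 \<xi>"
      by (simp add: T1_def T2_def X1_def ode_p algebra_simps power2_eq_square)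
    also have "\<alpha> * T2 \<xi> - X2 \<xi> - ?b * sin (\<theta> \<xi>) = - T1 \<xi>"
      using ode_q[of \<xi>] by (simp add: T1_def T2_def X2_def algebra_simps)
    also have "T2 \<xi> *\<^sub>R ep x t - (- T1 \<xi>) *\<^sub>R et x t = mt x t"
      by (simp add: mt_def \<xi>_def)
    finally show ?thesis by simp
  qed
  have "llgs_solution \<alpha> \<beta> c h \<mu> m"
    unfolding llgs_solution_def
  proof (rule conjI, (rule allI)+, goal_cases)
    case (1 x t)
    show ?case by (simp add: m_def norm_polar)
  next
    case 2
    show ?case
      by (rule exI[of _ mt], rule exI[of _ mx], rule exI[of _ mxx], intro conjI allI)
        (rule dt dx dxx cont_mt cont_mxx eq)+
  qed
  then show ?thesis by (simp only: m_def [abs_def])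
qed

text \<open>
  A wavetrain is the case of velocity zero with constant angle \<open>\<theta>\<close> and constant wavenumber \<open>k\<close>. The
  two profile equations then determine the frequency twice, and \<open>balance\<close> says that the values agree.
\<close>

lemma wavetrainI:
  assumes "\<alpha> > 0" and \<theta>: "sin \<theta> \<noteq> 0" and balance: "\<alpha> * (h + (k\<^sup>2 - \<mu>) * cos \<theta>) = beta_bar \<beta> c \<theta>"
  shows "\<exists>\<omega>. wavetrain \<alpha> \<beta> c h \<mu> k \<omega> \<theta>"
proof -
  define \<Omega> where "\<Omega> = beta_bar \<beta> c \<theta> / \<alpha>"
  have \<Omega>: "h + (k\<^sup>2 - \<mu>) * cos \<theta> = \<Omega>" "\<alpha> * \<Omega> = beta_bar \<beta> c \<theta>"
    using \<open>\<alpha> > 0\<close> balance by (auto simp: \<Omega>_def field_simps)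
  have "llgs_solution \<alpha> \<beta> c h \<mu> (\<lambda>x t. polar (k * (x - 0 * t) + \<Omega> * t) \<theta>)"
    by (rule travelling_profile_solves_llgs
        [where \<theta> = "\<lambda>\<xi>. \<theta>" and p = "\<lambda>\<xi>. 0" and q = "\<lambda>\<xi>. k" and p' = "\<lambda>\<xi>. 0" and q' = "\<lambda>\<xi>. 0" and s = 0])
      (auto intro!: derivative_eq_intros simp: \<Omega>)
  then have "wavetrain \<alpha> \<beta> c h \<mu> k (- \<Omega>) \<theta>"
    using \<theta> by (simp add: wavetrain_def)
  then show ?thesis by blast
qed

section \<open>The profile equations as a slow-fast system\<close>

text \<open>
  With \<open>tan (\<theta> / 2) = exp a\<close> the equation \<open>\<theta>' = w * sin \<theta>\<close> becomes \<open>a' = w\<close>. The two poles move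
  to \<open>a = \<plusminus>\<infinity>\<close> and the coordinate singularities disappear from the equations.
\<close>

definition wall_angle :: "real \<Rightarrow> real" where
  "wall_angle a = 2 * arctan (exp a)"

lemma wall_angle_bounds: "0 < wall_angle a" "wall_angle a < pi"
  using arctan_bounded[of "exp a"] by (auto simp: wall_angle_def)

lemma sin_wall_angle_pos: "sin (wall_angle a) > 0"
  using wall_angle_bounds by (intro sin_gt_zero)

lemma cos_wall_angle: "cos (wall_angle a) = - tanh a"
proof -
  have "cos (wall_angle a) = (1 - (exp a)\<^sup>2) / (1 + (exp a)\<^sup>2)"
    unfolding wall_angle_def cos_double
    by (simp add: cos_arctan sin_arctan power_divide diff_divide_distrib add_pos_nonneg)
  also have "\<dots> = - tanh a"
  proof -
    have "tanh a = (exp a * (exp a - inverse (exp a))) / (exp a * (exp a + inverse (exp a)))"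
      by (simp add: tanh_altdef exp_minus)
    also have "\<dots> = ((exp a)\<^sup>2 - 1) / (1 + (exp a)\<^sup>2)"
      by (simp add: right_diff_distrib distrib_left power2_eq_square add.commute)
    finally show ?thesis by (simp add: minus_divide_left)
  qed
  finally show ?thesis .
qed

lemma wall_angle_has_derivative: "(wall_angle has_real_derivative sin (wall_angle a)) (at a)"
proof -
  have pos: "1 + (exp a)\<^sup>2 > 0" by (simp add: add_pos_nonneg)
  have "(wall_angle has_real_derivative 2 * (inverse (1 + (exp a)\<^sup>2) * exp a)) (at a)"
    unfolding wall_angle_def by (auto intro!: derivative_eq_intros)
  moreover have "sin (wall_angle a) = 2 * (inverse (1 + (exp a)\<^sup>2) * exp a)"
    unfolding wall_angle_def sin_double
    using pos by (simp add: cos_arctan sin_arctan field_simps)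
  ultimately show ?thesis by simp
qed

lemma wall_angle_at_top: "(wall_angle \<longlongrightarrow> pi) at_top"
proof -
  have "((\<lambda>a. 2 * arctan (exp a)) \<longlongrightarrow> 2 * (pi / 2)) at_top"
    by (intro tendsto_intros filterlim_compose[OF tendsto_arctan_at_top exp_at_top])
  then show ?thesis by (simp add: wall_angle_def[abs_def])
qed

lemma wall_angle_at_bot: "(wall_angle \<longlongrightarrow> 0) at_bot"
proof -
  have "((\<lambda>a. 2 * arctan (exp a)) \<longlongrightarrow> 2 * arctan 0) at_bot"
    by (intro tendsto_intros exp_at_bot)
  then show ?thesis by (simp add: wall_angle_def[abs_def])
qed

lemma tanh_Lipschitz: "\<bar>tanh a - tanh b\<bar> \<le> \<bar>a - b\<bar>" for a b :: real
proof -
  have "norm (tanh a - tanh b) \<le> 1 * norm (a - b)"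
  proof (rule field_differentiable_bound[where S = UNIV])
    show "(tanh has_field_derivative 1 - (tanh z)\<^sup>2) (at z within UNIV)" for z :: real
      using cosh_real_pos[of z] by (auto intro!: derivative_eq_intros simp: less_le)
    show "norm (1 - (tanh z)\<^sup>2) \<le> 1" for z :: real
    proof -
      have "\<bar>tanh z\<bar> \<le> 1" using tanh_real_bounds[of z] by (simp add: abs_if)
      then have "(tanh z)\<^sup>2 \<le> 1" by (simp add: abs_square_le_1)
      moreover have "(tanh z)\<^sup>2 \<ge> 0" by simp
      ultimately show ?thesis unfolding real_norm_def by linarith
    qed
  qed auto
  then show ?thesis by simp
qed

text \<open>
  The nonlinearity of the fast equation. Let \<open>\<epsilon> = 1 / s\<close>, let \<open>q = \<phi>'\<close> and \<open>p = \<theta>'\<close> be the profile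
  derivatives, and put \<open>w = s * p / sin \<theta>\<close>, \<open>Q = \<Omega> - s * q\<close>. In the rescaled variable \<open>t = s * \<xi>\<close> the profile
  equations become \<open>a' = \<epsilon>\<^sup>2 * w\<close> together with
  \<open>w' = - \<alpha> * w - Q + h + cos \<theta> * (q\<^sup>2 - (\<epsilon> * w)\<^sup>2 - \<mu>)\<close> and
  \<open>Q' = w - \<alpha> * Q + beta_bar \<beta> c \<theta> + 2 * cos \<theta> * \<epsilon> * w * q\<close>.
  The linear part is multiplication of \<open>z = w + \<i> * Q\<close> by \<open>- \<alpha> + \<i>\<close>, and the
  two quadratic terms are the real and imaginary part of the single square \<open>(q + \<i> * \<epsilon> * w)\<^sup>2\<close>, where
  \<open>q + \<i> * \<epsilon> * w = \<Omega>1 + \<epsilon> * (\<Omega>0 + \<i> * z)\<close> because \<open>\<Omega> = \<Omega>0 + \<Omega>1 * s\<close>.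
\<close>

definition wall_field ::
  "real \<Rightarrow> real \<Rightarrow> real \<Rightarrow> real \<Rightarrow> real \<Rightarrow> real \<Rightarrow> real \<Rightarrow> real \<Rightarrow> complex \<Rightarrow> complex" where
  "wall_field \<beta> c h \<mu> \<Omega>0 \<Omega>1 \<epsilon> a z =
     Complex h (\<beta> / (1 - c * tanh a))
     - complex_of_real (tanh a) * ((of_real \<Omega>1 + of_real \<epsilon> * (of_real \<Omega>0 + \<i> * z))\<^sup>2 - of_real \<mu>)"

lemma wall_field_parts:
  fixes a \<epsilon> \<Omega>0 \<Omega>1 :: real
  defines "q \<equiv> \<lambda>z. \<Omega>1 + \<epsilon> * (\<Omega>0 - Im z)"
  shows "Re (wall_field \<beta> c h \<mu> \<Omega>0 \<Omega>1 \<epsilon> a z) = h - tanh a * ((q z)\<^sup>2 - (\<epsilon> * Re z)\<^sup>2 - \<mu>)"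
    and "Im (wall_field \<beta> c h \<mu> \<Omega>0 \<Omega>1 \<epsilon> a z) = \<beta> / (1 - c * tanh a) - tanh a * (2 * \<epsilon> * Re z * q z)"
  by (simp_all add: wall_field_def q_def power2_eq_square algebra_simps)

text \<open>
  For \<open>\<epsilon> = 0\<close> the nonlinearity is the bounded function \<open>F0\<close> of the slow variable alone; the remainder
  is \<open>\<epsilon> * tanh a * N\<close> with \<open>N\<close> quadratic in \<open>z\<close>. So the radius can be fixed from the bound \<open>M0\<close> of \<open>F0\<close>,
  with one unit to spare, and for small \<open>\<epsilon>\<close> the remainder uses at most that unit. The slow speed
  carries the factor \<open>\<epsilon>\<^sup>2\<close> and the Lipschitz constant in \<open>z\<close> the factor \<open>\<epsilon>\<close>, which gives the gap condition.
\<close>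

lemma wall_field_slow_fast:
  fixes \<alpha> \<beta> c h \<mu> \<Omega>0 \<Omega>1 :: real
  assumes \<alpha>: "\<alpha> > 0" and c: "\<bar>c\<bar> < 1"
  obtains R L C \<epsilon>0 where "R \<ge> 0" "\<epsilon>0 > 0"
    and "\<And>\<epsilon>. 0 < \<bar>\<epsilon>\<bar> \<Longrightarrow> \<bar>\<epsilon>\<bar> < \<epsilon>0 \<Longrightarrow>
      slow_fast (Complex (- \<alpha>) 1) (wall_field \<beta> c h \<mu> \<Omega>0 \<Omega>1 \<epsilon>) (\<epsilon>\<^sup>2) R L (\<bar>\<epsilon>\<bar> * C)"
proof -
  define d where "d = 1 - \<bar>c\<bar>"
  have d: "d > 0" using c by (simp add: d_def)
  define M0 where "M0 = \<bar>h\<bar> + \<bar>\<beta>\<bar> / d + \<bar>\<Omega>1\<^sup>2 - \<mu>\<bar>"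
  define L0 where "L0 = \<bar>\<beta>\<bar> * \<bar>c\<bar> / d\<^sup>2 + \<bar>\<Omega>1\<^sup>2 - \<mu>\<bar>"
  define R where "R = (M0 + 1) / \<alpha>"
  define K where "K = \<bar>\<Omega>0\<bar> + R"
  define C1 where "C1 = 2 * \<bar>\<Omega>1\<bar> * K + K\<^sup>2"
  define C2 where "C2 = 2 * \<bar>\<Omega>1\<bar> + 2 * K"
  define L where "L = L0 + C1"
  define \<epsilon>0 where "\<epsilon>0 = min 1 (min (1 / (C1 + 1)) (\<alpha> / 4 / (2 * L / \<alpha> + C2 + 1)))"
  have M0: "M0 \<ge> 0" and L0: "L0 \<ge> 0" using d by (auto simp: M0_def L0_def)
  have R: "R \<ge> 0" using M0 \<alpha> by (simp add: R_def)
  have K: "K \<ge> 0" using R by (simp add: K_def)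
  have C1: "C1 \<ge> 0" and C2: "C2 \<ge> 0" using K by (auto simp: C1_def C2_def)
  have L: "L \<ge> 0" using L0 C1 by (simp add: L_def)
  have "2 * L / \<alpha> + C2 + 1 > 0" using L \<alpha> C2 by (simp add: add_nonneg_pos)
  then have \<epsilon>0: "\<epsilon>0 > 0" using \<alpha> C1 by (simp add: \<epsilon>0_def)
  define F0 where "F0 a = Complex h (\<beta> / (1 - c * tanh a)) - of_real (tanh a * (\<Omega>1\<^sup>2 - \<mu>))" for a
  define N where "N \<epsilon> z = 2 * of_real \<Omega>1 * (\<Omega>0 + \<i> * z) + of_real \<epsilon> * (\<Omega>0 + \<i> * z)\<^sup>2" for \<epsilon> :: real and z
  have tanh1: "\<bar>tanh a\<bar> \<le> 1" for a :: real
    using tanh_real_bounds[of a] by (simp add: abs_if)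
  have split: "wall_field \<beta> c h \<mu> \<Omega>0 \<Omega>1 \<epsilon> a z = F0 a - of_real (\<epsilon> * tanh a) * N \<epsilon> z" for \<epsilon> a z
    by (simp add: wall_field_def F0_def N_def power2_eq_square algebra_simps)
  have den: "1 - c * tanh a \<ge> d" for a
  proof -
    have "c * tanh a \<le> \<bar>c\<bar> * \<bar>tanh a\<bar>" by (metis abs_ge_self abs_mult)
    also have "\<dots> \<le> \<bar>c\<bar> * 1" using tanh1 by (intro mult_left_mono) auto
    finally show ?thesis by (simp add: d_def)
  qed
  have F0_bound: "norm (F0 a) \<le> M0" for a
  proof -
    have "norm (F0 a) \<le> norm (Complex h (\<beta> / (1 - c * tanh a))) + \<bar>tanh a * (\<Omega>1\<^sup>2 - \<mu>)\<bar>"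
      unfolding F0_def by (metis norm_of_real norm_triangle_ineq4)
    also have "norm (Complex h (\<beta> / (1 - c * tanh a))) \<le> \<bar>h\<bar> + \<bar>\<beta> / (1 - c * tanh a)\<bar>"
      using cmod_le[of "Complex h (\<beta> / (1 - c * tanh a))"] by simp
    also have "\<bar>\<beta> / (1 - c * tanh a)\<bar> \<le> \<bar>\<beta>\<bar> / d"
      using den[of a] d by (simp add: abs_divide frac_le)
    also have "\<bar>tanh a * (\<Omega>1\<^sup>2 - \<mu>)\<bar> \<le> 1 * \<bar>\<Omega>1\<^sup>2 - \<mu>\<bar>"
      unfolding abs_mult by (intro mult_right_mono tanh1) simp
    finally show ?thesis by (simp add: M0_def)
  qed
  have F0_Lip: "norm (F0 a - F0 b) \<le> L0 * \<bar>a - b\<bar>" for a b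
  proof -
    have eq: "\<beta> / (1 - c * tanh a) - \<beta> / (1 - c * tanh b) =
        \<beta> * c * (tanh a - tanh b) / ((1 - c * tanh a) * (1 - c * tanh b))"
      using den[of a] den[of b] d by (simp add: field_simps)
    have "d\<^sup>2 \<le> (1 - c * tanh a) * (1 - c * tanh b)"
      unfolding power2_eq_square using den[of a] den[of b] d by (intro mult_mono) auto
    then have "\<bar>\<beta> / (1 - c * tanh a) - \<beta> / (1 - c * tanh b)\<bar> \<le> \<bar>\<beta>\<bar> * \<bar>c\<bar> * \<bar>tanh a - tanh b\<bar> / d\<^sup>2"
      unfolding eq using d by (simp add: abs_divide abs_mult frac_le flip: abs_mult)
    also have "\<dots> = \<bar>\<beta>\<bar> * \<bar>c\<bar> / d\<^sup>2 * \<bar>tanh a - tanh b\<bar>" by simp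
    finally have 1: "\<bar>\<beta> / (1 - c * tanh a) - \<beta> / (1 - c * tanh b)\<bar> \<le> \<bar>\<beta>\<bar> * \<bar>c\<bar> / d\<^sup>2 * \<bar>tanh a - tanh b\<bar>" .
    have 2: "\<bar>(tanh a - tanh b) * (\<Omega>1\<^sup>2 - \<mu>)\<bar> = \<bar>\<Omega>1\<^sup>2 - \<mu>\<bar> * \<bar>tanh a - tanh b\<bar>"
      by (simp add: abs_mult)
    have "norm (F0 a - F0 b) \<le> \<bar>Re (F0 a - F0 b)\<bar> + \<bar>Im (F0 a - F0 b)\<bar>" by (rule cmod_le)
    also have "Re (F0 a - F0 b) = - ((tanh a - tanh b) * (\<Omega>1\<^sup>2 - \<mu>))"
      by (simp add: F0_def algebra_simps)
    also have "Im (F0 a - F0 b) = \<beta> / (1 - c * tanh a) - \<beta> / (1 - c * tanh b)"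
      by (simp add: F0_def)
    finally have "norm (F0 a - F0 b) \<le> L0 * \<bar>tanh a - tanh b\<bar>"
      using 1 2 by (simp add: L0_def distrib_right)
    also have "\<dots> \<le> L0 * \<bar>a - b\<bar>" by (intro mult_left_mono tanh_Lipschitz L0)
    finally show ?thesis .
  qed
  have \<zeta>: "norm (\<Omega>0 + \<i> * z) \<le> K" if "norm z \<le> R" for z
  proof -
    have "norm (\<Omega>0 + \<i> * z) \<le> norm (complex_of_real \<Omega>0) + norm (\<i> * z)"
      by (rule norm_triangle_ineq)
    then show ?thesis using that by (simp add: K_def norm_mult)
  qed
  have N_bound: "norm (N \<epsilon> z) \<le> C1" if "\<bar>\<epsilon>\<bar> \<le> 1" "norm z \<le> R" for \<epsilon> z
  proof -
    let ?\<zeta> = "\<Omega>0 + \<i> * z"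
    have "norm (N \<epsilon> z) \<le> norm (2 * complex_of_real \<Omega>1 * ?\<zeta>) + norm (of_real \<epsilon> * ?\<zeta>\<^sup>2)"
      unfolding N_def by (rule norm_triangle_ineq)
    also have "\<dots> = 2 * \<bar>\<Omega>1\<bar> * norm ?\<zeta> + \<bar>\<epsilon>\<bar> * (norm ?\<zeta>)\<^sup>2"
      by (simp add: norm_mult norm_power)
    also have "\<dots> \<le> 2 * \<bar>\<Omega>1\<bar> * K + 1 * K\<^sup>2"
      using \<zeta>[OF that(2)] that(1) by (intro add_mono mult_mono power_mono) auto
    finally show ?thesis by (simp add: C1_def)
  qed
  have N_Lip: "norm (N \<epsilon> y - N \<epsilon> z) \<le> C2 * norm (y - z)" if "\<bar>\<epsilon>\<bar> \<le> 1" "norm y \<le> R" "norm z \<le> R" for \<epsilon> y z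
  proof -
    let ?\<zeta> = "\<Omega>0 + \<i> * y" and ?\<eta> = "\<Omega>0 + \<i> * z"
    have "N \<epsilon> y - N \<epsilon> z = (2 * \<Omega>1 + of_real \<epsilon> * (?\<zeta> + ?\<eta>)) * (\<i> * (y - z))"
      by (simp add: N_def power2_eq_square algebra_simps)
    then have "norm (N \<epsilon> y - N \<epsilon> z) = norm (2 * \<Omega>1 + of_real \<epsilon> * (?\<zeta> + ?\<eta>)) * norm (y - z)"
      by (simp add: norm_mult)
    also have "\<dots> \<le> C2 * norm (y - z)"
    proof (rule mult_right_mono)
      have "norm (?\<zeta> + ?\<eta>) \<le> K + K"
        by (rule order_trans[OF norm_triangle_ineq]) (intro add_mono \<zeta> that)
      then have "\<bar>\<epsilon>\<bar> * norm (?\<zeta> + ?\<eta>) \<le> 1 * (K + K)"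
        using that(1) by (intro mult_mono) auto
      moreover have "norm (2 * \<Omega>1 + of_real \<epsilon> * (?\<zeta> + ?\<eta>)) \<le> 2 * \<bar>\<Omega>1\<bar> + \<bar>\<epsilon>\<bar> * norm (?\<zeta> + ?\<eta>)"
        by (rule order_trans[OF norm_triangle_ineq]) (simp add: norm_mult)
      ultimately show "norm (2 * \<Omega>1 + of_real \<epsilon> * (?\<zeta> + ?\<eta>)) \<le> C2"
        by (simp add: C2_def)
    qed simp
    finally show ?thesis .
  qed
  show ?thesis
  proof
    show "R \<ge> 0" "\<epsilon>0 > 0" by fact+
    fix \<epsilon> :: real assume \<epsilon>: "0 < \<bar>\<epsilon>\<bar>" "\<bar>\<epsilon>\<bar> < \<epsilon>0"
    have \<epsilon>1: "\<bar>\<epsilon>\<bar> \<le> 1" using \<epsilon> by (simp add: \<epsilon>0_def)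
    have \<epsilon>C1: "\<bar>\<epsilon>\<bar> * C1 \<le> 1"
    proof -
      have "\<bar>\<epsilon>\<bar> < 1 / (C1 + 1)" using \<epsilon> by (simp add: \<epsilon>0_def)
      then have "\<bar>\<epsilon>\<bar> * (C1 + 1) < 1" using C1 by (simp add: field_simps)
      then show ?thesis by (simp add: algebra_simps)
    qed
    have \<epsilon>gap: "\<bar>\<epsilon>\<bar> * (2 * L / \<alpha> + C2) \<le> \<alpha> / 4"
    proof -
      have "\<bar>\<epsilon>\<bar> < \<alpha> / 4 / (2 * L / \<alpha> + C2 + 1)" using \<epsilon> by (simp add: \<epsilon>0_def)
      then have "\<bar>\<epsilon>\<bar> * (2 * L / \<alpha> + C2 + 1) < \<alpha> / 4"
        using \<open>2 * L / \<alpha> + C2 + 1 > 0\<close> by (simp only: pos_less_divide_eq)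
      then show ?thesis by (simp add: distrib_left)
    qed
    show "slow_fast (Complex (- \<alpha>) 1) (wall_field \<beta> c h \<mu> \<Omega>0 \<Omega>1 \<epsilon>) (\<epsilon>\<^sup>2) R L (\<bar>\<epsilon>\<bar> * C2)"
    proof
      show "Re (Complex (- \<alpha>) 1) < 0" "0 < \<epsilon>\<^sup>2" "0 \<le> L" "0 \<le> \<bar>\<epsilon>\<bar> * C2"
        using \<alpha> \<epsilon> L C2 by auto
      have "\<epsilon>\<^sup>2 \<le> \<bar>\<epsilon>\<bar>" using \<epsilon>1 mult_left_mono[of "\<bar>\<epsilon>\<bar>" 1 "\<bar>\<epsilon>\<bar>"] by (simp add: power2_eq_square)
      then have "2 * L / \<alpha> * \<epsilon>\<^sup>2 \<le> 2 * L / \<alpha> * \<bar>\<epsilon>\<bar>"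
        using L \<alpha> by (intro mult_left_mono) auto
      moreover have "2 * L / \<alpha> * \<bar>\<epsilon>\<bar> + \<bar>\<epsilon>\<bar> * C2 \<le> \<alpha> / 4"
        using \<epsilon>gap unfolding distrib_left mult.commute[of "\<bar>\<epsilon>\<bar>" "2 * L / \<alpha>"] .
      ultimately have "2 * L / \<alpha> * \<epsilon>\<^sup>2 + \<bar>\<epsilon>\<bar> * C2 \<le> \<alpha> / 4"
        by linarith
      then show "2 * L * \<epsilon>\<^sup>2 / - Re (Complex (- \<alpha>) 1) + \<bar>\<epsilon>\<bar> * C2 \<le> - Re (Complex (- \<alpha>) 1) / 4"
        by simp
    next
      fix z :: complex and a :: real assume z: "norm z \<le> R"
      have "norm (wall_field \<beta> c h \<mu> \<Omega>0 \<Omega>1 \<epsilon> a z) \<le> norm (F0 a) + norm (of_real (\<epsilon> * tanh a) * N \<epsilon> z)"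
        unfolding split by (rule norm_triangle_ineq4)
      also have "norm (of_real (\<epsilon> * tanh a) * N \<epsilon> z) = \<bar>\<epsilon>\<bar> * (\<bar>tanh a\<bar> * norm (N \<epsilon> z))"
        by (simp add: norm_mult abs_mult)
      also have "\<dots> \<le> \<bar>\<epsilon>\<bar> * (1 * C1)"
        using tanh1 N_bound[OF \<epsilon>1 z] C1 by (intro mult_left_mono mult_mono) auto
      also have "norm (F0 a) + \<bar>\<epsilon>\<bar> * (1 * C1) \<le> M0 + 1" using F0_bound[of a] \<epsilon>C1 by simp
      also have "\<dots> = - Re (Complex (- \<alpha>) 1) * R" using \<alpha> by (simp add: R_def)
      finally show "norm (wall_field \<beta> c h \<mu> \<Omega>0 \<Omega>1 \<epsilon> a z) \<le> - Re (Complex (- \<alpha>) 1) * R" by simp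
    next
      fix y z :: complex and a b :: real assume yz: "norm y \<le> R" "norm z \<le> R"
      have "wall_field \<beta> c h \<mu> \<Omega>0 \<Omega>1 \<epsilon> a y - wall_field \<beta> c h \<mu> \<Omega>0 \<Omega>1 \<epsilon> b z =
         (F0 a - F0 b) - of_real \<epsilon> * (of_real (tanh a - tanh b) * N \<epsilon> y)
           - of_real \<epsilon> * (of_real (tanh b) * (N \<epsilon> y - N \<epsilon> z))"
        by (simp add: split algebra_simps)
      also have "norm \<dots> \<le> norm (F0 a - F0 b) + norm (of_real \<epsilon> * (of_real (tanh a - tanh b) * N \<epsilon> y))
          + norm (of_real \<epsilon> * (of_real (tanh b) * (N \<epsilon> y - N \<epsilon> z)))"
        by (rule order_trans[OF norm_triangle_ineq4 add_right_mono[OF norm_triangle_ineq4]])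
      also have "norm (of_real \<epsilon> * (of_real (tanh a - tanh b) * N \<epsilon> y)) = \<bar>\<epsilon>\<bar> * (\<bar>tanh a - tanh b\<bar> * norm (N \<epsilon> y))"
        unfolding norm_mult norm_of_real ..
      also have "\<dots> \<le> 1 * (\<bar>a - b\<bar> * C1)"
        using \<epsilon>1 tanh_Lipschitz N_bound[OF \<epsilon>1 yz(1)] C1 by (intro mult_mono) auto
      also have "norm (of_real \<epsilon> * (of_real (tanh b) * (N \<epsilon> y - N \<epsilon> z))) = \<bar>\<epsilon>\<bar> * (\<bar>tanh b\<bar> * norm (N \<epsilon> y - N \<epsilon> z))"
        unfolding norm_mult norm_of_real ..
      also have "\<dots> \<le> \<bar>\<epsilon>\<bar> * (1 * (C2 * norm (y - z)))"
        using tanh1 N_Lip[OF \<epsilon>1 yz] C2 by (intro mult_left_mono mult_mono) auto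
      also note F0_Lip[of a b]
      finally show "norm (wall_field \<beta> c h \<mu> \<Omega>0 \<Omega>1 \<epsilon> a y - wall_field \<beta> c h \<mu> \<Omega>0 \<Omega>1 \<epsilon> b z)
          \<le> L * \<bar>a - b\<bar> + \<bar>\<epsilon>\<bar> * C2 * norm (y - z)"
        by (simp add: L_def algebra_simps)
    qed
  qed
qed

section \<open>Domain walls\<close>

text \<open>
  Undoing the rescaling \<open>t = s * \<xi>\<close>. Every derivative in \<open>\<xi>\<close> produces a factor \<open>s\<close>, which cancels
  against the powers of \<open>1 / s\<close> in the rescaled variables.
\<close>

lemma bounded_orbit_coherent_structure:
  fixes \<alpha> \<beta> c h \<mu> \<Omega>0 \<Omega>1 s :: real and A :: "real \<Rightarrow> real" and Z :: "real \<Rightarrow> complex"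
  defines "F \<equiv> wall_field \<beta> c h \<mu> \<Omega>0 \<Omega>1 (1 / s)" and "lam \<equiv> Complex (- \<alpha>) 1"
  assumes s: "s \<noteq> 0"
    and A: "\<And>t. (A has_real_derivative (1 / s)\<^sup>2 * Re (Z t)) (at t)"
    and Z: "\<And>t. (Z has_vector_derivative lam * Z t + F (A t) (Z t)) (at t)"
    and F_cont: "continuous_on UNIV (\<lambda>t. F (A t) (Z t))"
  obtains \<phi> where
    "coherent_structure \<alpha> \<beta> c h \<mu> s (\<Omega>0 + \<Omega>1 * s) \<phi> (\<lambda>\<xi>. wall_angle (A (s * \<xi>)))"
proof -
  define W where "W \<xi> = lam * Z (s * \<xi>) + F (A (s * \<xi>)) (Z (s * \<xi>))" for \<xi>
  define \<theta> where "\<theta> \<xi> = wall_angle (A (s * \<xi>))" for \<xi>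
  define p where "p \<xi> = 1 / s * Re (Z (s * \<xi>)) * sin (\<theta> \<xi>)" for \<xi>
  define q where "q \<xi> = \<Omega>1 + 1 / s * (\<Omega>0 - Im (Z (s * \<xi>)))" for \<xi>
  define p' where "p' \<xi> = Re (W \<xi>) * sin (\<theta> \<xi>) + 1 / s * Re (Z (s * \<xi>)) * (cos (\<theta> \<xi>) * p \<xi>)" for \<xi>
  define q' where "q' \<xi> = - Im (W \<xi>)" for \<xi>
  have scale: "((\<lambda>\<xi>. s * \<xi>) has_real_derivative s) (at \<xi>)" for \<xi>
    by (auto intro!: derivative_eq_intros)
  have dA: "((\<lambda>\<xi>. A (s * \<xi>)) has_real_derivative 1 / s * Re (Z (s * \<xi>))) (at \<xi>)" for \<xi>
    using DERIV_chain2[OF A scale, of \<xi>] s by (simp add: power2_eq_square)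
  have d\<theta>: "(\<theta> has_real_derivative p \<xi>) (at \<xi>)" for \<xi>
    unfolding \<theta>_def using DERIV_chain2[OF wall_angle_has_derivative dA, of \<xi>]
    by (simp add: p_def \<theta>_def mult.commute)
  have dZ: "((\<lambda>\<xi>. Z (s * \<xi>)) has_vector_derivative s *\<^sub>R W \<xi>) (at \<xi>)" for \<xi>
    using vector_diff_chain_at[of "\<lambda>\<xi>. s * \<xi>" s \<xi> Z "W \<xi>"] scale[of \<xi>] Z[of "s * \<xi>"]
    by (simp add: o_def W_def has_real_derivative_iff_has_vector_derivative)
  have dRe: "((\<lambda>\<xi>. Re (Z (s * \<xi>))) has_real_derivative s * Re (W \<xi>)) (at \<xi>)"
    and dIm: "((\<lambda>\<xi>. Im (Z (s * \<xi>))) has_real_derivative s * Im (W \<xi>)) (at \<xi>)" for \<xi>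
    using bounded_linear.has_vector_derivative[OF bounded_linear_Re dZ[of \<xi>]] bounded_linear.has_vector_derivative[OF bounded_linear_Im dZ[of \<xi>]]
    by (simp_all add: has_real_derivative_iff_has_vector_derivative)
  have dp: "(p has_real_derivative p' \<xi>) (at \<xi>)" for \<xi>
  proof -
    have "((\<lambda>\<xi>. 1 / s * Re (Z (s * \<xi>)) * sin (\<theta> \<xi>)) has_real_derivative
        1 / s * (s * Re (W \<xi>)) * sin (\<theta> \<xi>) + (cos (\<theta> \<xi>) * p \<xi>) * (1 / s * Re (Z (s * \<xi>)))) (at \<xi>)"
      by (intro DERIV_mult DERIV_cmult dRe DERIV_chain2[OF DERIV_sin d\<theta>])
    then show ?thesis using s by (simp add: p_def[abs_def] p'_def mult_ac)
  qed
  have dq: "(q has_real_derivative q' \<xi>) (at \<xi>)" for \<xi>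
  proof -
    have "((\<lambda>\<xi>. \<Omega>1 + 1 / s * (\<Omega>0 - Im (Z (s * \<xi>)))) has_real_derivative
        0 + 1 / s * (0 - s * Im (W \<xi>))) (at \<xi>)"
      by (intro DERIV_add DERIV_cmult DERIV_diff DERIV_const dIm)
    then show ?thesis using s by (simp add: q_def[abs_def] q'_def)
  qed
  have cont: "continuous_on UNIV \<theta>" "continuous_on UNIV p" "continuous_on UNIV q"
    using d\<theta> dp dq by (auto intro!: DERIV_continuous_on)
  have contZ: "continuous_on UNIV (\<lambda>\<xi>. Z (s * \<xi>))"
    by (intro continuous_at_imp_continuous_on ballI has_vector_derivative_continuous[OF dZ])
  have "continuous_on UNIV (\<lambda>\<xi>. F (A (s * \<xi>)) (Z (s * \<xi>)))"
    by (rule continuous_on_compose2[OF F_cont, of UNIV "\<lambda>\<xi>. s * \<xi>"]) (auto intro: continuous_intros)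
  then have contW: "continuous_on UNIV W"
    unfolding W_def by (intro continuous_intros contZ)
  have contp': "continuous_on UNIV p'"
    unfolding p'_def by (intro continuous_intros contW contZ cont)
  have contq': "continuous_on UNIV q'"
    unfolding q'_def by (intro continuous_intros contW)
  obtain \<phi> where "\<And>\<xi>. (\<phi> has_vector_derivative q \<xi>) (at \<xi>)"
    using continuous_imp_antiderivative[OF cont(3)] by blast
  then have d\<phi>: "(\<phi> has_real_derivative q \<xi>) (at \<xi>)" for \<xi>
    by (simp add: has_real_derivative_iff_has_vector_derivative)
  have ReW: "Re (W \<xi>) = - \<alpha> * Re (Z (s * \<xi>)) - Im (Z (s * \<xi>)) + h
      + cos (\<theta> \<xi>) * ((q \<xi>)\<^sup>2 - (1 / s * Re (Z (s * \<xi>)))\<^sup>2 - \<mu>)" for \<xi>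
    by (simp add: W_def lam_def F_def wall_field_parts q_def \<theta>_def cos_wall_angle)
  have ImW: "Im (W \<xi>) = Re (Z (s * \<xi>)) - \<alpha> * Im (Z (s * \<xi>)) + beta_bar \<beta> c (\<theta> \<xi>)
      + cos (\<theta> \<xi>) * (2 * (1 / s) * Re (Z (s * \<xi>)) * q \<xi>)" for \<xi>
    by (simp add: W_def lam_def F_def wall_field_parts q_def \<theta>_def cos_wall_angle beta_bar_def)
  have Q: "\<Omega>0 + \<Omega>1 * s - s * q \<xi> = Im (Z (s * \<xi>))" for \<xi>
    using s by (simp add: q_def distrib_left mult.commute)
  have sp: "s * p \<xi> = Re (Z (s * \<xi>)) * sin (\<theta> \<xi>)" for \<xi>
    using s by (simp add: p_def)
  have "llgs_solution \<alpha> \<beta> c h \<mu> (\<lambda>x t. polar (\<phi> (x - s * t) + (\<Omega>0 + \<Omega>1 * s) * t) (\<theta> (x - s * t)))"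
  proof (rule travelling_profile_solves_llgs[OF d\<theta> d\<phi> dp dq contp' contq'])
    fix \<xi>
    show "p' \<xi> = sin (\<theta> \<xi>) * (h + ((q \<xi>)\<^sup>2 - \<mu>) * cos (\<theta> \<xi>) - (\<Omega>0 + \<Omega>1 * s - s * q \<xi>)) - \<alpha> * s * p \<xi>"
      unfolding Q mult.assoc[of \<alpha> s] sp p'_def ReW
      by (simp add: p_def algebra_simps power2_eq_square)
    show "sin (\<theta> \<xi>) * q' \<xi> = sin (\<theta> \<xi>) * (\<alpha> * (\<Omega>0 + \<Omega>1 * s - s * q \<xi>) - beta_bar \<beta> c (\<theta> \<xi>))
        - (s + 2 * cos (\<theta> \<xi>) * q \<xi>) * p \<xi>"
      unfolding Q distrib_right[of s] sp q'_def ImW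
      by (simp add: p_def algebra_simps)
  qed
  moreover have "deriv \<phi> = q" "deriv \<theta> = p"
    using d\<phi> d\<theta> by (auto intro!: ext DERIV_imp_deriv)
  moreover have diff: "f differentiable_on UNIV" if "\<And>\<xi>. (f has_real_derivative f' \<xi>) (at \<xi>)" for f f'
    using that unfolding differentiable_on_def by (metis real_differentiable_def)
  moreover have "sin (\<theta> \<xi>) \<noteq> 0" for \<xi>
    using sin_wall_angle_pos[of "A (s * \<xi>)"] by (simp add: \<theta>_def)
  ultimately have "coherent_structure \<alpha> \<beta> c h \<mu> s (\<Omega>0 + \<Omega>1 * s) \<phi> \<theta>"
    unfolding coherent_structure_def using diff[OF d\<phi>] diff[OF d\<theta>] diff[OF dp] diff[OF dq] by simp
  then show ?thesis by (intro that) (simp add: \<theta>_def[abs_def])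
qed

lemma wall_angle_domain_wall_type:
  assumes "s \<noteq> 0" and "(filterlim A at_bot at_bot \<and> filterlim A at_top at_top) \<or>
         (filterlim A at_top at_bot \<and> filterlim A at_bot at_top)"
  shows "domain_wall_type (\<lambda>\<xi>. wall_angle (A (s * \<xi>)))"
proof -
  have orient: "(filterlim (\<lambda>\<xi>. s * \<xi>) at_bot at_bot \<and> filterlim (\<lambda>\<xi>. s * \<xi>) at_top at_top) \<or>
      (filterlim (\<lambda>\<xi>. s * \<xi>) at_top at_bot \<and> filterlim (\<lambda>\<xi>. s * \<xi>) at_bot at_top)"
  proof -
    have pos: "filterlim (\<lambda>\<xi>. r * \<xi>) at_bot at_bot" "filterlim (\<lambda>\<xi>. r * \<xi>) at_top at_top"
      if "r > 0" for r :: real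
      using that
      by (auto intro!: filterlim_tendsto_pos_mult_at_bot[OF tendsto_const _ filterlim_ident]
        filterlim_tendsto_pos_mult_at_top[OF tendsto_const _ filterlim_ident])
    show ?thesis
    proof (cases "s > 0")
      case True
      then show ?thesis using pos by blast
    next
      case False
      then have "- s > 0" using assms by simp
      from pos[OF this]
      have "filterlim (\<lambda>\<xi>. - (s * \<xi>)) at_bot at_bot" "filterlim (\<lambda>\<xi>. - (s * \<xi>)) at_top at_top"
        by simp_all
      then have "filterlim (\<lambda>\<xi>. s * \<xi>) at_top at_bot" "filterlim (\<lambda>\<xi>. s * \<xi>) at_bot at_top"
        using filterlim_uminus_at_top[of "\<lambda>\<xi>. s * \<xi>" at_bot]
          filterlim_uminus_at_bot[of "\<lambda>\<xi>. s * \<xi>" at_top] by blast+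
      then show ?thesis by blast
    qed
  qed
  have "((\<lambda>\<xi>. wall_angle (A (s * \<xi>))) \<longlongrightarrow> 0) G"
    if "filterlim A at_bot H" "filterlim (\<lambda>\<xi>. s * \<xi>) H G" for G H
    by (intro filterlim_compose[OF wall_angle_at_bot] filterlim_compose[OF that])
  moreover have "((\<lambda>\<xi>. wall_angle (A (s * \<xi>))) \<longlongrightarrow> pi) G"
    if "filterlim A at_top H" "filterlim (\<lambda>\<xi>. s * \<xi>) H G" for G H
    by (intro filterlim_compose[OF wall_angle_at_top] filterlim_compose[OF that])
  ultimately show ?thesis
    using orient assms(2) unfolding domain_wall_type_def by blast
qed

theorem corollary2:
  fixes \<alpha> \<beta> c h \<mu> \<Omega>0 \<Omega>1 :: real
  assumes "\<alpha> > 0"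
    and "-1 < c" and "c < 1"
    and "bandgap \<alpha> \<beta> c h \<mu> \<Omega>0 \<Omega>1"
  shows "\<exists>s2>0. \<forall>s. \<bar>s\<bar> > s2 \<longrightarrow>
           (\<exists>\<phi> \<theta>. coherent_structure \<alpha> \<beta> c h \<mu> s (\<Omega>0 + \<Omega>1 * s) \<phi> \<theta> \<and> domain_wall_type \<theta>)"
proof -
  obtain s1 where s1: "s1 > 0" and no_wavetrain: "\<And>s \<theta> \<omega>. \<bar>s\<bar> > s1 \<Longrightarrow> \<theta> \<in> {0<..<pi} \<Longrightarrow>
      \<not> wavetrain \<alpha> \<beta> c h \<mu> ((\<Omega>0 + \<Omega>1 * s - beta_bar \<beta> c \<theta> / \<alpha>) / s) \<omega> \<theta>"
    using assms(4) unfolding bandgap_def by blast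
  have c: "\<bar>c\<bar> < 1" using assms(2,3) by linarith
  obtain R L C \<epsilon>0 where R: "R \<ge> 0" and \<epsilon>0: "\<epsilon>0 > 0"
    and sf: "\<And>\<epsilon>. 0 < \<bar>\<epsilon>\<bar> \<Longrightarrow> \<bar>\<epsilon>\<bar> < \<epsilon>0 \<Longrightarrow>
      slow_fast (Complex (- \<alpha>) 1) (wall_field \<beta> c h \<mu> \<Omega>0 \<Omega>1 \<epsilon>) (\<epsilon>\<^sup>2) R L (\<bar>\<epsilon>\<bar> * C)"
    by (rule wall_field_slow_fast[OF assms(1) c, of \<beta> h \<mu> \<Omega>0 \<Omega>1]) blast
  have "\<exists>\<phi> \<theta>. coherent_structure \<alpha> \<beta> c h \<mu> s (\<Omega>0 + \<Omega>1 * s) \<phi> \<theta> \<and> domain_wall_type \<theta>"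
    if s: "\<bar>s\<bar> > max s1 (1 / \<epsilon>0)" for s
  proof -
    have s0: "s \<noteq> 0" "\<bar>s\<bar> > s1" using s s1 by auto
    have "1 / \<epsilon>0 < \<bar>s\<bar>" using s by simp
    then have "\<bar>1 / s\<bar> < \<epsilon>0"
      using \<epsilon>0 s0(1) by (simp add: abs_divide field_simps)
    then interpret slow_fast "Complex (- \<alpha>) 1" "wall_field \<beta> c h \<mu> \<Omega>0 \<Omega>1 (1 / s)" "(1 / s)\<^sup>2" R L "\<bar>1 / s\<bar> * C"
      using s0(1) by (intro sf) auto
    \<comment> \<open>A rest point has \<open>Re z = 0\<close> and \<open>Im z = beta_bar \<beta> c \<theta> / \<alpha>\<close>, so its wavenumber is exactly the
        one in the bandgap condition.\<close>
    have no_eq: "Complex (- \<alpha>) 1 * z + wall_field \<beta> c h \<mu> \<Omega>0 \<Omega>1 (1 / s) a z \<noteq> 0"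
      if z: "Re z = 0" for a z
    proof
      assume eq: "Complex (- \<alpha>) 1 * z + wall_field \<beta> c h \<mu> \<Omega>0 \<Omega>1 (1 / s) a z = 0"
      define \<theta> where "\<theta> = wall_angle a"
      define k where "k = \<Omega>1 + 1 / s * (\<Omega>0 - Im z)"
      have re: "Im z = h + (k\<^sup>2 - \<mu>) * cos \<theta>"
        using arg_cong[OF eq, of Re] z
        by (simp add: wall_field_parts k_def \<theta>_def cos_wall_angle algebra_simps)
      have im: "beta_bar \<beta> c \<theta> = \<alpha> * Im z"
        using arg_cong[OF eq, of Im] z
        by (simp add: wall_field_parts \<theta>_def cos_wall_angle beta_bar_def)
      have "beta_bar \<beta> c \<theta> / \<alpha> = Im z" using im assms(1) by simp
      then have k: "k = (\<Omega>0 + \<Omega>1 * s - beta_bar \<beta> c \<theta> / \<alpha>) / s"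
        using s0(1) by (simp add: k_def field_simps)
      have "sin \<theta> \<noteq> 0" using sin_wall_angle_pos[of a] by (simp add: \<theta>_def)
      then obtain \<omega> where "wavetrain \<alpha> \<beta> c h \<mu> k \<omega> \<theta>"
        using wavetrainI[OF assms(1)] re im by metis
      moreover have "\<theta> \<in> {0<..<pi}" using wall_angle_bounds[of a] by (simp add: \<theta>_def)
      ultimately show False using no_wavetrain[OF s0(2)] k by blast
    qed
    obtain A Z where orbit: "bounded_orbit A Z"
      and ends: "(filterlim A at_bot at_bot \<and> filterlim A at_top at_top) \<or>
         (filterlim A at_top at_bot \<and> filterlim A at_bot at_top)"
      using connecting_orbit[OF R no_eq] by blast
    have A: "(A has_real_derivative (1 / s)\<^sup>2 * Re (Z t)) (at t)"
      and Z: "(Z has_vector_derivative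
          Complex (- \<alpha>) 1 * Z t + wall_field \<beta> c h \<mu> \<Omega>0 \<Omega>1 (1 / s) (A t) (Z t)) (at t)"
      and bound: "norm (Z t) \<le> R" for t
      using orbit unfolding slaved_def by blast+
    have "continuous_on UNIV A" "continuous_on UNIV Z"
      by (intro continuous_at_imp_continuous_on ballI DERIV_isCont[OF A]
          has_vector_derivative_continuous[OF Z])+
    then have "continuous_on UNIV (\<lambda>t. wall_field \<beta> c h \<mu> \<Omega>0 \<Omega>1 (1 / s) (A t) (Z t))"
      using bound by (rule continuous_on_F)
    then obtain \<phi> where
      "coherent_structure \<alpha> \<beta> c h \<mu> s (\<Omega>0 + \<Omega>1 * s) \<phi> (\<lambda>\<xi>. wall_angle (A (s * \<xi>)))"
      using bounded_orbit_coherent_structure[OF s0(1) A Z] by blast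
    with wall_angle_domain_wall_type[OF s0(1) ends] show ?thesis by blast
  qed
  moreover have "max s1 (1 / \<epsilon>0) > 0" using s1 by simp
  ultimately show ?thesis by blast
qed

end
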